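(* Let $X^n\subset\mathbb{P}^{n+1}$ be a hypersurface of degree $d\geq 2$ and dimension $n\geq 1$ defined over $\mathbb{F}_q$. If $k_{X^n}=0$, then $$N_q(X^n)\leq (d-1)q^n+(d-2)N_q(\mathbb{P}^{n-1})+1,$$ and equality holds if and only if $d=2$ and, up to projective equivalence, either $n=1$ and $X^1:\ X_0^2+X_1^2+X_2^2=0$ is a nonsingular plane conic, or $n=2$ and $X^2:\ f(X_0,X_1)+X_2X_3=0$ is a nonsingular elliptic surface, where $f(X_0,X_1)=\alpha X_0^2+X_0X_1+X_1^2$ is an irreducible binary quadratic form with $\alpha\in\{t\in\mathbb{F}_q\ |\ t+t^2+t^4+\dots+t^{2^{r-1}}=1\}$ if $q=2^r$ for some $r\in\mathbb{Z}_{\geq 1}$, and such that $1-4\alpha$ is a non-square if $q$ is odd.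
   Context: $\mathbb{F}_q$ is the finite field with $q=p^r$ elements, $p$ prime, $r\geq 1$ an integer. $N_q(Y)$ denotes the number of $\mathbb{F}_q$-points of an algebraic set $Y$ defined by equations over $\mathbb{F}_q$; in particular $N_q(\mathbb{P}^N)=q^N+q^{N-1}+\dots+q+1$. The invariant $k_{X^n}$ is the maximum $h$ such that there exists an $\mathbb{F}_q$-linear subspace $\mathbb{P}^h$ of $\mathbb{P}^{n+1}$ contained in $X^n$; thus $k_{X^n}=0$ means that $X^n$ has an $\mathbb{F}_q$-point but contains no $\mathbb{F}_q$-line. The coordinates of $\mathbb{P}^{n+1}$ are $X_0,\dots,X_{n+1}$.
   Formalization: For n=1 the equation X_0^2+X_1^2+X_2^2=0 is required only for odd q; for even q the case is any nonsingular plane conic, since there the displayed conic is a double line while X_0^2+X_1X_2=0 attains equality. *)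

theory Defs
  imports
    "HOL-Library.Poly_Mapping"
    "HOL-Library.Cardinality"
    "HOL-Algebra.Algebraic_Closure_Type"
    "Jordan_Normal_Form.VS_Connect"
begin

text \<open>
  Polynomials in the variables \<open>X\<^sub>0, X\<^sub>1, \<dots>\<close>: finitely supported coefficient functions on
  monomials, a monomial being its finitely supported exponent function. The ring structure is
  the convolution product of \<^theory>\<open>HOL-Library.Poly_Mapping\<close>.
\<close>

type_synonym 'a mpoly = "(nat \<Rightarrow>\<^sub>0 nat) \<Rightarrow>\<^sub>0 'a"

definition Var :: "nat \<Rightarrow> 'a::comm_ring_1 mpoly" where
  "Var i = Poly_Mapping.single (Poly_Mapping.single i 1) 1"

definition Const :: "'a::comm_ring_1 \<Rightarrow> 'a mpoly" where
  "Const c = Poly_Mapping.single 0 c"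

text \<open>
  The value of \<open>F\<close> at \<open>x\<close> after mapping its coefficients along \<open>\<phi>\<close>. Used with \<open>\<phi> = id\<close> for
  points over the base field, with \<open>\<phi> = to_ac\<close> for points over the algebraic closure, and
  with \<open>\<phi> = Const\<close> for the substitution of polynomials for the variables.
\<close>

definition peval :: "('a::comm_ring_1 \<Rightarrow> 'b::comm_ring_1) \<Rightarrow> 'a mpoly \<Rightarrow> (nat \<Rightarrow> 'b) \<Rightarrow> 'b" where
  "peval \<phi> F x = (\<Sum>m\<in>Poly_Mapping.keys F. \<phi> (Poly_Mapping.lookup F m) *
     (\<Prod>i\<in>Poly_Mapping.keys m. x i ^ Poly_Mapping.lookup m i))"

definition pderivative :: "nat \<Rightarrow> 'a::comm_ring_1 mpoly \<Rightarrow> 'a mpoly" where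
  "pderivative i F = (\<Sum>m\<in>Poly_Mapping.keys F.
     Poly_Mapping.single (m - Poly_Mapping.single i 1)
       (of_nat (Poly_Mapping.lookup m i) * Poly_Mapping.lookup F m))"

text \<open>
  A hypersurface in projective \<open>N\<close>-space is given by a nonzero form in \<open>X\<^sub>0, \<dots>, X\<^sub>N\<close>; it may be
  reducible or non-reduced, and its degree is the degree of the form.
\<close>

definition hypersurface :: "nat \<Rightarrow> nat \<Rightarrow> 'a::comm_ring_1 mpoly \<Rightarrow> bool" where
  "hypersurface N d F \<longleftrightarrow> F \<noteq> 0 \<and>
     (\<forall>m\<in>Poly_Mapping.keys F. Poly_Mapping.keys m \<subseteq> {..N} \<and>
        (\<Sum>i\<in>Poly_Mapping.keys m. Poly_Mapping.lookup m i) = d)"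

definition proj_space :: "nat \<Rightarrow> 'a::field vec set set" where
  "proj_space N = (carrier_vec (N + 1) - {0\<^sub>v (N + 1)}) //
     {(x, y). x \<in> carrier_vec (N + 1) - {0\<^sub>v (N + 1)} \<and> (\<exists>c. c \<noteq> 0 \<and> y = c \<cdot>\<^sub>v x)}"

definition proj_zeros :: "('k::field \<Rightarrow> 'a::field) \<Rightarrow> nat \<Rightarrow> 'k mpoly \<Rightarrow> 'a vec set set" where
  "proj_zeros \<phi> N F = {P \<in> proj_space N. \<forall>x\<in>P. peval \<phi> F (\<lambda>i. x $ i) = 0}"

definition num_points :: "nat \<Rightarrow> 'k::{finite,field} mpoly \<Rightarrow> nat" where
  "num_points N F = card (proj_zeros id N F)"

text \<open>
  The set \<open>L\<close> of points over the algebraic closure is a projective linear subspace of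
  dimension \<open>h\<close> that is defined over the base field.
\<close>

definition rational_subspace :: "nat \<Rightarrow> nat \<Rightarrow> 'k::field alg_closure vec set set \<Rightarrow> bool" where
  "rational_subspace N h L \<longleftrightarrow>
     (\<exists>B :: 'k vec set. B \<subseteq> carrier_vec (N + 1) \<and> finite B \<and> card B = h + 1 \<and>
        \<not> LinearCombinations.module.lin_dep class_ring (module_vec TYPE('k) (N + 1)) B \<and>
        L = {P \<in> proj_space N. P \<subseteq> LinearCombinations.module.span class_ring
               (module_vec TYPE('k alg_closure) (N + 1)) (map_vec to_ac ` B)})"

text \<open>
  Containment of a linear subspace in the hypersurface is containment of varieties, that is,
  over the algebraic closure: a form of degree larger than the order of the field can vanish at
  all rational points of a line without containing that line. If the hypersurface has no
  rational point, the invariant is \<open>-1\<close>, the dimension of the empty subspace.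
\<close>

definition k_inv :: "nat \<Rightarrow> 'k::field mpoly \<Rightarrow> int" where
  "k_inv N F = Max (insert (-1)
     (int ` {h. \<exists>L. rational_subspace N h L \<and> L \<subseteq> proj_zeros to_ac N F}))"

definition nonsingular :: "nat \<Rightarrow> 'k::field mpoly \<Rightarrow> bool" where
  "nonsingular N F \<longleftrightarrow>
     (\<forall>P\<in>proj_zeros to_ac N F. \<forall>x\<in>P. \<exists>i\<le>N. peval to_ac (pderivative i F) (\<lambda>j. x $ j) \<noteq> 0)"

text \<open>
  Over a finite field a form is not determined by its values, so the change of coordinates is
  a substitution of linear forms. The factor \<open>c\<close> is there because a form is determined by its
  hypersurface only up to a scalar.
\<close>

definition proj_equiv :: "nat \<Rightarrow> 'k::field mpoly \<Rightarrow> 'k mpoly \<Rightarrow> bool" where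
  "proj_equiv N F G \<longleftrightarrow>
     (\<exists>A c. A \<in> carrier_mat (N + 1) (N + 1) \<and> invertible_mat A \<and> c \<noteq> 0 \<and>
        peval Const F (\<lambda>i. \<Sum>j\<le>N. Const (A $$ (i, j)) * Var j) = Const c * G)"

definition binary_form :: "'k::field \<Rightarrow> 'k mpoly" where
  "binary_form \<alpha> = Const \<alpha> * Var 0 ^ 2 + Var 0 * Var 1 + Var 1 ^ 2"

end

(*
  On a line through a rational point b of X, the form restricts to a nonzero polynomial of degree
  d with a zero at b, and with a double zero at b if the line is tangent. Counting points line by
  line gives the bound, with equality only if b is smooth and every line through b carries as many
  rational points as possible. For d >= 3 a tangent line at b then carries a second rational point
  Q and is also tangent at Q, so it meets X in fewer points than required; hence d = 2.

  A quadric with a smooth rational point splits off a hyperbolic plane, and the absence of lines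
  makes the form anisotropic on the n-dimensional complement. Over a finite field this forces
  n <= 2 and leads to the two normal forms. Conversely, on a smooth quadric without lines every
  tangent line carries one rational point and every other line through b carries two.
*)

theory Submission
  imports Defs
begin

section \<open>Evaluation of polynomials\<close>

text \<open>The count runs over vectors instead of projective lines: every vector \<open>v\<close>
  gives the affine line \<open>v + t b\<close>, whose point at infinity is \<open>b\<close>. Along
  it the form is a polynomial in \<open>t\<close> of formal degree \<open>d\<close>. Its top
  coefficient is the value at \<open>b\<close> and the next one is the differential at
  \<open>b\<close> applied to \<open>v\<close>, so a zero at \<open>b\<close> lowers the degree by
  one and tangency by one more. Hence there are at most \<open>d - 1\<close> roots, or
  \<open>d - 2\<close> for tangent directions, provided that the polynomial is nonzero. This must
  mean nonzero as a formal polynomial, since one of degree at least \<open>q\<close> may vanish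
  everywhere; therefore restriction to a line is evaluation at linear polynomials, and containment
  of lines is tested over the algebraic closure. For quadrics the obstacle is characteristic two,
  where independent orthogonal vectors cannot span an anisotropic plane. The form is therefore kept
  next to its polar form, subspaces are measured by cardinality, and the fact that every element is
  a square replaces diagonalization.\<close>

definition mon_val :: "(nat \<Rightarrow>\<^sub>0 nat) \<Rightarrow> (nat \<Rightarrow> 'b::comm_ring_1) \<Rightarrow> 'b" where
  "mon_val m x = (\<Prod>i\<in>Poly_Mapping.keys m. x i ^ Poly_Mapping.lookup m i)"

definition mon_deg :: "(nat \<Rightarrow>\<^sub>0 nat) \<Rightarrow> nat" where
  "mon_deg m = (\<Sum>i\<in>Poly_Mapping.keys m. Poly_Mapping.lookup m i)"

lemma mon_val_superset:
  assumes "finite S" "Poly_Mapping.keys m \<subseteq> S"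
  shows "mon_val m x = (\<Prod>i\<in>S. x i ^ Poly_Mapping.lookup m i)"
  unfolding mon_val_def using assms
  by (intro prod.mono_neutral_left) (auto simp: in_keys_iff)

lemma mon_deg_superset:
  assumes "finite S" "Poly_Mapping.keys m \<subseteq> S"
  shows "mon_deg m = (\<Sum>i\<in>S. Poly_Mapping.lookup m i)"
  unfolding mon_deg_def using assms
  by (intro sum.mono_neutral_left) (auto simp: in_keys_iff)

lemma mon_val_add: "mon_val (m + m') x = mon_val m x * mon_val m' x"
proof -
  let ?S = "Poly_Mapping.keys m \<union> Poly_Mapping.keys m'"
  have "Poly_Mapping.keys (m + m') \<subseteq> ?S" by (rule Poly_Mapping.keys_add)
  then show ?thesis
    by (simp add: mon_val_superset[of ?S] lookup_add power_add prod.distrib)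
qed

lemma mon_val_single [simp]: "mon_val (Poly_Mapping.single i e) x = x i ^ e"
  by (cases "e = 0") (simp_all add: mon_val_def)

lemma mon_val_0 [simp]: "mon_val 0 x = 1"
  by (simp add: mon_val_def)

lemma peval_eq: "peval \<phi> F x =
    (\<Sum>m\<in>Poly_Mapping.keys F. \<phi> (Poly_Mapping.lookup F m) * mon_val m x)"
  by (simp add: peval_def mon_val_def)

lemma sum_singles: "F = (\<Sum>m\<in>Poly_Mapping.keys F. Poly_Mapping.single m (Poly_Mapping.lookup F m))"
  by (rule poly_mapping_eqI)
     (auto simp: lookup_sum lookup_single when_def in_keys_iff)

lemma peval_cong:
  assumes "\<And>m i. m \<in> Poly_Mapping.keys F \<Longrightarrow> i \<in> Poly_Mapping.keys m \<Longrightarrow> x i = y i"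
  shows "peval \<phi> F x = peval \<phi> F y"
  unfolding peval_def using assms
  by (intro sum.cong refl arg_cong2[where f="(*)"] prod.cong) auto

context comm_ring_hom
begin

lemma hom_mon_val: "hom (mon_val m x) = mon_val m (\<lambda>i. hom (x i))"
  by (simp add: mon_val_def hom_prod hom_power)

lemma hom_peval: "hom (peval \<phi> F x) = peval (\<lambda>c. hom (\<phi> c)) F (\<lambda>i. hom (x i))"
  by (simp add: peval_eq hom_sum hom_mult hom_mon_val)

lemma peval_superset:
  assumes "finite S" "Poly_Mapping.keys F \<subseteq> S"
  shows "peval hom F x = (\<Sum>m\<in>S. hom (Poly_Mapping.lookup F m) * mon_val m x)"
  unfolding peval_eq using assms
  by (intro sum.mono_neutral_left) (auto simp: in_keys_iff)

lemma peval_0 [simp]: "peval hom 0 x = 0"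
  by (simp add: peval_def)

lemma peval_single [simp]: "peval hom (Poly_Mapping.single m c) x = hom c * mon_val m x"
  by (cases "c = 0") (simp_all add: peval_eq)

lemma peval_add [simp]: "peval hom (F + G) x = peval hom F x + peval hom G x"
proof -
  let ?S = "Poly_Mapping.keys F \<union> Poly_Mapping.keys G"
  have "Poly_Mapping.keys (F + G) \<subseteq> ?S" by (rule Poly_Mapping.keys_add)
  then show ?thesis
    by (simp add: peval_superset[of ?S] lookup_add hom_add distrib_right sum.distrib)
qed

lemma peval_sum [simp]: "peval hom (\<Sum>i\<in>A. f i) x = (\<Sum>i\<in>A. peval hom (f i) x)"
  by (induction A rule: infinite_finite_induct) auto

lemma peval_mult [simp]: "peval hom (F * G) x = peval hom F x * peval hom G x"
proof -
  have "F * G = (\<Sum>m\<in>Poly_Mapping.keys F. Poly_Mapping.single m (Poly_Mapping.lookup F m)) *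
    (\<Sum>m\<in>Poly_Mapping.keys G. Poly_Mapping.single m (Poly_Mapping.lookup G m))"
    using sum_singles[of F] sum_singles[of G] by simp
  also have "\<dots> = (\<Sum>m\<in>Poly_Mapping.keys F. \<Sum>m'\<in>Poly_Mapping.keys G.
      Poly_Mapping.single (m + m') (Poly_Mapping.lookup F m * Poly_Mapping.lookup G m'))"
    by (simp add: sum_product mult_single)
  finally have "peval hom (F * G) x = (\<Sum>m\<in>Poly_Mapping.keys F. \<Sum>m'\<in>Poly_Mapping.keys G.
      (hom (Poly_Mapping.lookup F m) * mon_val m x) * (hom (Poly_Mapping.lookup G m') * mon_val m' x))"
    by (simp add: hom_mult mon_val_add mult_ac)
  then show ?thesis by (simp add: sum_product peval_eq)
qed

lemma peval_Const [simp]: "peval hom (Const c) x = hom c"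
  by (simp add: Const_def)

lemma peval_Var [simp]: "peval hom (Var i) x = x i"
  by (simp add: Var_def)

end

interpretation id_hom: comm_ring_hom "id :: 'a::comm_ring_1 \<Rightarrow> 'a"
  by unfold_locales simp_all

interpretation Const_hom: comm_ring_hom "Const :: 'a::comm_ring_1 \<Rightarrow> 'a mpoly"
  by unfold_locales (simp_all add: Const_def single_add mult_single)

interpretation to_ac_hom: comm_ring_hom "to_ac :: 'a::field \<Rightarrow> 'a alg_closure"
  by unfold_locales simp_all

lemma (in comm_ring_hom) comm_ring_hom_const_poly: "comm_ring_hom (\<lambda>c. [:hom c:])"
  by unfold_locales (simp_all add: hom_add hom_mult one_pCons)

section \<open>Restriction to a line\<close>

definition homog :: "nat \<Rightarrow> 'a::comm_ring_1 mpoly \<Rightarrow> bool" where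
  "homog d F \<longleftrightarrow> (\<forall>m\<in>Poly_Mapping.keys F. mon_deg m = d)"

text \<open>The formal polynomial F(u + t v) in t. It keeps coefficients that the values over a
  small field would not determine.\<close>

definition line_poly ::
  "('a::comm_ring_1 \<Rightarrow> 'b::comm_ring_1) \<Rightarrow> 'a mpoly \<Rightarrow> (nat \<Rightarrow> 'b) \<Rightarrow> (nat \<Rightarrow> 'b) \<Rightarrow> 'b poly" where
  "line_poly \<phi> F u v = peval (\<lambda>c. [:\<phi> c:]) F (\<lambda>i. [:u i, v i:])"

text \<open>Encodes p(t) = t^d p'(1/t). The degree \<open>d\<close> is formal because leading
  coefficients may vanish.\<close>

definition reflected :: "nat \<Rightarrow> 'b::comm_ring_1 poly \<Rightarrow> 'b poly \<Rightarrow> bool" where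
  "reflected d p p' \<longleftrightarrow> degree p \<le> d \<and> degree p' \<le> d \<and> (\<forall>k\<le>d. coeff p k = coeff p' (d - k))"

lemma reflected_1: "reflected 0 1 1"
  by (simp add: reflected_def)

lemma reflected_linear:
  assumes "reflected d p p'"
  shows "reflected (Suc d) ([:u, v:] * p) ([:v, u:] * p')"
proof -
  have d: "degree p \<le> d" "degree p' \<le> d" and c: "\<And>k. k \<le> d \<Longrightarrow> coeff p k = coeff p' (d - k)"
    using assms by (auto simp: reflected_def)
  have "degree ([:u, v:] * p) \<le> Suc d" if "degree p \<le> d" for u v and p :: "'a poly"
    using that degree_mult_le[of "[:u, v:]" p] degree_pCons_le[of u "[:v:]"] by simp
  moreover have "coeff ([:u, v:] * p) k = coeff ([:v, u:] * p') (Suc d - k)" if "k \<le> Suc d" for k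
  proof (cases k)
    case 0
    then show ?thesis using c[of 0] coeff_eq_0[of p' "Suc d"] d by simp
  next
    case (Suc j)
    show ?thesis
    proof (cases "j = d")
      case True
      then show ?thesis using Suc c[of d] coeff_eq_0[of p "Suc d"] d by simp
    next
      case False
      then have "j < d" using that Suc by simp
      then obtain e where "d = j + Suc e" by (metis add_Suc_right less_imp_Suc_add)
      then show ?thesis using Suc c[of j] c[of "Suc j"] by simp
    qed
  qed
  ultimately show ?thesis using d by (simp add: reflected_def)
qed

lemma reflected_power:
  assumes "reflected d p p'"
  shows "reflected (e + d) ([:u, v:] ^ e * p) ([:v, u:] ^ e * p')"
proof (induction e)
  case (Suc e)
  show ?case using reflected_linear[OF Suc, of u v] by (simp add: mult.assoc del: mult_pCons_left)
qed (simp add: assms)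

lemma reflected_mon_val:
  "reflected (mon_deg m) (mon_val m (\<lambda>i. [:u i, v i:])) (mon_val m (\<lambda>i. [:v i, u i:]))"
proof -
  have "reflected (\<Sum>i\<in>S. e i) (\<Prod>i\<in>S. [:u i, v i:] ^ e i) (\<Prod>i\<in>S. [:v i, u i:] ^ e i)"
    if "finite S" for S :: "nat set" and e
    using that by (induction S) (auto simp: reflected_1 intro: reflected_power)
  then show ?thesis by (simp add: mon_val_def mon_deg_def)
qed

lemma reflected_smult_add:
  assumes "reflected d p p'" "reflected d r r'"
  shows "reflected d ([:c:] * p + r) ([:c:] * p' + r')"
  using assms unfolding reflected_def
  by (auto intro!: degree_add_le degree_smult_le[THEN order_trans])

lemma reflected_line_poly:
  assumes "homog d F"
  shows "reflected d (line_poly \<phi> F u v) (line_poly \<phi> F v u)"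
proof -
  have "reflected d (\<Sum>m\<in>S. [:c m:] * mon_val m (\<lambda>i. [:u i, v i:]))
      (\<Sum>m\<in>S. [:c m:] * mon_val m (\<lambda>i. [:v i, u i:]))"
    if "finite S" "\<forall>m\<in>S. mon_deg m = d" for S and c :: "_ \<Rightarrow> 'b"
    using that
  proof (induction S)
    case empty
    then show ?case by (simp add: reflected_def)
  next
    case (insert m S)
    then have "mon_deg m = d" by simp
    then have "reflected d (mon_val m (\<lambda>i. [:u i, v i:])) (mon_val m (\<lambda>i. [:v i, u i:]))"
      using reflected_mon_val by metis
    from reflected_smult_add[OF this, of _ _ "c m"] insert show ?case
      by (simp del: mult_pCons_left)
  qed
  then show ?thesis using assms by (simp add: line_poly_def peval_eq homog_def del: mult_pCons_left)
qed

lemma degree_line_poly: "homog d F \<Longrightarrow> degree (line_poly \<phi> F u v) \<le> d"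
  using reflected_line_poly reflected_def by blast

text \<open>Exchanging \<open>u\<close> and \<open>v\<close> exchanges the parameters 0 and
  infinity, so top coefficients can be computed as bottom ones.\<close>

lemma coeff_line_poly_swap:
  "homog d F \<Longrightarrow> k \<le> d \<Longrightarrow> coeff (line_poly \<phi> F u v) k = coeff (line_poly \<phi> F v u) (d - k)"
  using reflected_line_poly reflected_def by blast

context comm_ring_hom
begin

lemma poly_line_poly: "poly (line_poly hom F u v) t = peval hom F (\<lambda>i. u i + t * v i)"
proof -
  interpret E: comm_ring_hom "\<lambda>p. poly p t" by unfold_locales simp_all
  show ?thesis unfolding line_poly_def by (subst E.hom_peval) simp
qed

lemma coeff_line_poly_0: "coeff (line_poly hom F u v) 0 = peval hom F u"
  using poly_line_poly[of F u v 0] by (simp add: poly_0_coeff_0)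

lemma coeff_line_poly_top: "homog d F \<Longrightarrow> coeff (line_poly hom F u v) d = peval hom F v"
  using coeff_line_poly_swap[of d F d hom u v] by (simp add: coeff_line_poly_0)

lemma peval_scale:
  assumes "homog d F"
  shows "peval hom F (\<lambda>i. t * x i) = t ^ d * peval hom F x"
proof -
  have "mon_val m (\<lambda>i. t * x i) = t ^ mon_deg m * mon_val m x" for m
    by (simp add: mon_val_def mon_deg_def power_mult_distrib prod.distrib power_sum)
  then show ?thesis using assms
    by (simp add: peval_eq homog_def sum_distrib_left mult_ac)
qed

end

text \<open>The linear coefficient is the derivative at 0, obtained from the product rule. The
  subtraction in the exponent is exact because \<open>i\<close> ranges over the variables that occur
  in \<open>m\<close>.\<close>

lemma coeff_mon_val_1:
  fixes u v :: "nat \<Rightarrow> 'b::idom"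
  shows "coeff (mon_val m (\<lambda>i. [:u i, v i:])) 1 =
    (\<Sum>i\<in>Poly_Mapping.keys m. of_nat (Poly_Mapping.lookup m i) * v i *
       mon_val (m - Poly_Mapping.single i 1) u)"
proof -
  let ?K = "Poly_Mapping.keys m" and ?e = "Poly_Mapping.lookup m"
  let ?p = "mon_val m (\<lambda>i. [:u i, v i:])"
  have "coeff ?p 1 = poly (pderiv ?p) 0" by (simp add: poly_0_coeff_0 coeff_pderiv)
  also have "\<dots> = (\<Sum>i\<in>?K. (\<Prod>j\<in>?K - {i}. u j ^ ?e j) * (of_nat (?e i) * u i ^ (?e i - 1) * v i))"
    unfolding mon_val_def
    by (simp add: pderiv_prod poly_sum poly_prod pderiv_power pderiv_pCons mult_ac)
  also have "\<dots> = (\<Sum>i\<in>?K. of_nat (?e i) * v i * mon_val (m - Poly_Mapping.single i 1) u)"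
  proof (rule sum.cong[OF refl])
    fix i assume i: "i \<in> ?K"
    have "mon_val (m - Poly_Mapping.single i 1) u =
        (\<Prod>j\<in>?K. u j ^ Poly_Mapping.lookup (m - Poly_Mapping.single i 1) j)"
      by (rule mon_val_superset) (auto simp: in_keys_iff lookup_minus)
    also have "\<dots> = u i ^ (?e i - 1) * (\<Prod>j\<in>?K - {i}. u j ^ ?e j)"
      using i by (subst prod.remove[of _ i])
        (auto simp: lookup_minus lookup_single intro!: arg_cong2[where f="(*)"] prod.cong)
    finally show "(\<Prod>j\<in>?K - {i}. u j ^ ?e j) * (of_nat (?e i) * u i ^ (?e i - 1) * v i) =
        of_nat (?e i) * v i * mon_val (m - Poly_Mapping.single i 1) u"
      by (simp add: mult_ac)
  qed
  finally show ?thesis .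
qed

text \<open>Links the formal restriction to the partial derivatives in which nonsingularity is
  phrased.\<close>

lemma coeff_line_poly_1:
  fixes hom :: "'a::comm_ring_1 \<Rightarrow> 'b::idom"
  assumes "comm_ring_hom hom" and "\<forall>m\<in>Poly_Mapping.keys F. Poly_Mapping.keys m \<subseteq> {..N}"
  shows "coeff (line_poly hom F u v) 1 = (\<Sum>i\<le>N. v i * peval hom (pderivative i F) u)"
proof -
  interpret comm_ring_hom hom by fact
  have "coeff (line_poly hom F u v) 1 = (\<Sum>m\<in>Poly_Mapping.keys F. hom (Poly_Mapping.lookup F m) *
      (\<Sum>i\<in>Poly_Mapping.keys m. of_nat (Poly_Mapping.lookup m i) * v i *
         mon_val (m - Poly_Mapping.single i 1) u))"
    by (simp add: line_poly_def peval_eq coeff_sum coeff_mon_val_1[simplified])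
  also have "\<dots> = (\<Sum>m\<in>Poly_Mapping.keys F. \<Sum>i\<le>N. hom (Poly_Mapping.lookup F m) *
      (of_nat (Poly_Mapping.lookup m i) * v i * mon_val (m - Poly_Mapping.single i 1) u))"
    unfolding sum_distrib_left using assms
    by (intro sum.cong refl sum.mono_neutral_left) (auto simp: in_keys_iff)
  also have "\<dots> = (\<Sum>i\<le>N. \<Sum>m\<in>Poly_Mapping.keys F. hom (Poly_Mapping.lookup F m) *
      (of_nat (Poly_Mapping.lookup m i) * v i * mon_val (m - Poly_Mapping.single i 1) u))"
    by (rule sum.swap)
  also have "\<dots> = (\<Sum>i\<le>N. v i * peval hom (pderivative i F) u)"
    by (simp add: pderivative_def sum_distrib_left hom_mult hom_of_nat mult_ac)
  finally show ?thesis .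
qed

section \<open>Counting vectors and points\<close>

lemma card_carrier_vec: "card (carrier_vec n :: 'k::finite vec set) = CARD('k) ^ n"
proof -
  have "bij_betw vec_of_list {xs :: 'k list. length xs = n} (carrier_vec n)"
  proof (rule bij_betwI[where g = list_of_vec])
    show "vec_of_list \<in> {xs :: 'k list. length xs = n} \<rightarrow> carrier_vec n"
      by (auto intro: carrier_vecI)
    show "list_of_vec \<in> carrier_vec n \<rightarrow> {xs :: 'k list. length xs = n}"
      by auto
  qed (simp_all add: list_vec vec_list)
  then have "card (carrier_vec n :: 'k vec set) = card {xs :: 'k list. length xs = n}"
    by (simp add: bij_betw_same_card)
  also have "\<dots> = CARD('k) ^ n"
    using card_lists_length_eq[of "UNIV :: 'k set" n] by simp
  finally show ?thesis .
qed

lemma finite_carrier_vec [simp]: "finite (carrier_vec n :: 'k::finite vec set)"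
proof -
  have "carrier_vec n \<subseteq> vec_of_list ` {xs :: 'k list. set xs \<subseteq> UNIV \<and> length xs = n}"
  proof
    fix x :: "'k vec" assume "x \<in> carrier_vec n"
    then have "list_of_vec x \<in> {xs. set xs \<subseteq> UNIV \<and> length xs = n}" by simp
    then have "vec_of_list (list_of_vec x) \<in> vec_of_list ` {xs. set xs \<subseteq> UNIV \<and> length xs = n}"
      by (rule imageI)
    then show "x \<in> vec_of_list ` {xs. set xs \<subseteq> UNIV \<and> length xs = n}"
      by (simp add: vec_list)
  qed
  then show ?thesis
    by (rule finite_subset) (rule finite_imageI, rule finite_lists_length_eq, simp)
qed

text \<open>Dimensions of these subspaces are tracked through cardinalities only, so bare closure
  properties suffice.\<close>

definition vec_subspace :: "nat \<Rightarrow> 'k::field vec set \<Rightarrow> bool" where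
  "vec_subspace n W \<longleftrightarrow> W \<subseteq> carrier_vec n \<and> 0\<^sub>v n \<in> W \<and>
     (\<forall>x\<in>W. \<forall>y\<in>W. x + y \<in> W) \<and> (\<forall>x\<in>W. \<forall>c. c \<cdot>\<^sub>v x \<in> W)"

definition lin_functional :: "'k::field vec set \<Rightarrow> ('k vec \<Rightarrow> 'k) \<Rightarrow> bool" where
  "lin_functional W T \<longleftrightarrow> (\<forall>x\<in>W. \<forall>y\<in>W. T (x + y) = T x + T y) \<and>
     (\<forall>x\<in>W. \<forall>c. T (c \<cdot>\<^sub>v x) = c * T x)"

lemma smult_zero_right [simp]: "c \<cdot>\<^sub>v 0\<^sub>v n = (0\<^sub>v n :: 'k::field vec)"
  by (intro eq_vecI) auto

lemma vec_subspace_kernel: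
  assumes "vec_subspace n W" "lin_functional W T"
  shows "vec_subspace n {x\<in>W. T x = 0}"
proof -
  have "T (0 \<cdot>\<^sub>v 0\<^sub>v n) = 0 * T (0\<^sub>v n)"
    using assms unfolding vec_subspace_def lin_functional_def by blast
  then have "T (0\<^sub>v n) = 0" by simp
  then show ?thesis using assms unfolding vec_subspace_def lin_functional_def by auto
qed

text \<open>A vector \<open>e\<close> with \<open>T e = 1\<close> splits \<open>W\<close> into the
  multiples of \<open>e\<close> and the kernel.\<close>

lemma card_kernel:
  fixes T :: "'k::{finite,field} vec \<Rightarrow> 'k"
  assumes W: "vec_subspace n W" and T: "lin_functional W T" and b: "b \<in> W" "T b \<noteq> 0"
  shows "CARD('k) * card {x\<in>W. T x = 0} = card W"
proof -
  define e where "e = inverse (T b) \<cdot>\<^sub>v b"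
  have e: "e \<in> W" "T e = 1"
    using W T b unfolding e_def vec_subspace_def lin_functional_def by auto
  have c: "W \<subseteq> carrier_vec n" using W by (simp add: vec_subspace_def)
  have "bij_betw (\<lambda>(s, x). s \<cdot>\<^sub>v e + x) (UNIV \<times> {x\<in>W. T x = 0}) W"
  proof (rule bij_betwI[where g = "\<lambda>x. (T x, x + (- T x) \<cdot>\<^sub>v e)"])
    show "(\<lambda>(s, x). s \<cdot>\<^sub>v e + x) \<in> UNIV \<times> {x\<in>W. T x = 0} \<rightarrow> W"
      using W e unfolding vec_subspace_def by auto
    show "(\<lambda>x. (T x, x + (- T x) \<cdot>\<^sub>v e)) \<in> W \<rightarrow> UNIV \<times> {x\<in>W. T x = 0}"
      using W T e unfolding vec_subspace_def lin_functional_def by auto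
    show "(\<lambda>x. (T x, x + (- T x) \<cdot>\<^sub>v e)) ((\<lambda>(s, x). s \<cdot>\<^sub>v e + x) p) = p"
      if p: "p \<in> UNIV \<times> {x\<in>W. T x = 0}" for p
    proof -
      obtain s x where p: "p = (s, x)" "x \<in> W" "T x = 0" using p by auto
      have "s \<cdot>\<^sub>v e \<in> W" using W e unfolding vec_subspace_def by auto
      then have "T (s \<cdot>\<^sub>v e + x) = s"
        using T e p unfolding lin_functional_def by auto
      moreover have "s \<cdot>\<^sub>v e + x + (- s) \<cdot>\<^sub>v e = x"
      proof -
        have "e \<in> carrier_vec n" "x \<in> carrier_vec n" using c e p by auto
        then show ?thesis by (intro eq_vecI) auto
      qed
      ultimately show ?thesis using p by simp
    qed
    show "(\<lambda>(s, x). s \<cdot>\<^sub>v e + x) ((\<lambda>x. (T x, x + (- T x) \<cdot>\<^sub>v e)) x) = x"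
      if "x \<in> W" for x
    proof -
      have "e \<in> carrier_vec n" "x \<in> carrier_vec n" using c e that by auto
      then show ?thesis by (auto intro!: eq_vecI)
    qed
  qed
  then show ?thesis using bij_betw_same_card by (fastforce simp: card_cartesian_product)
qed

lemma vec_subspace_carrier: "vec_subspace n (carrier_vec n)"
  by (simp add: vec_subspace_def)

lemma card_multiples:
  fixes b :: "'k::{finite,field} vec"
  assumes "b \<in> carrier_vec n" "b \<noteq> 0\<^sub>v n"
  shows "card {c \<cdot>\<^sub>v b |c. True} = CARD('k)" and "card {c \<cdot>\<^sub>v b |c. c \<noteq> 0} = CARD('k) - 1"
proof -
  obtain i where i: "i < n" "b $ i \<noteq> 0"
    using assms by (metis carrier_vecD eq_vecI index_zero_vec)
  have inj: "inj (\<lambda>c. c \<cdot>\<^sub>v b)"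
  proof (rule injI)
    fix c c' assume "c \<cdot>\<^sub>v b = c' \<cdot>\<^sub>v b"
    then have "(c \<cdot>\<^sub>v b) $ i = (c' \<cdot>\<^sub>v b) $ i" by simp
    then show "c = c'" using i assms by auto
  qed
  have "{c \<cdot>\<^sub>v b |c. True} = range (\<lambda>c. c \<cdot>\<^sub>v b)" by auto
  then show "card {c \<cdot>\<^sub>v b |c. True} = CARD('k)" using inj by (simp add: card_image)
  have "{c \<cdot>\<^sub>v b |c. c \<noteq> 0} = (\<lambda>c. c \<cdot>\<^sub>v b) ` (UNIV - {0})" by auto
  then show "card {c \<cdot>\<^sub>v b |c. c \<noteq> 0} = CARD('k) - 1"
    using inj by (simp add: card_image inj_on_subset card_Diff_singleton)
qed

section \<open>Projective points as classes of nonzero vectors\<close>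

abbreviation proj_rel :: "nat \<Rightarrow> ('k::field vec \<times> 'k vec) set" where
  "proj_rel N \<equiv> {(x, y). x \<in> carrier_vec (N + 1) - {0\<^sub>v (N + 1)} \<and> (\<exists>c. c \<noteq> 0 \<and> y = c \<cdot>\<^sub>v x)}"

lemma smult_vec_eq_0_iff:
  fixes x :: "'k::field vec"
  assumes "x \<in> carrier_vec n"
  shows "c \<cdot>\<^sub>v x = 0\<^sub>v n \<longleftrightarrow> c = 0 \<or> x = 0\<^sub>v n"
proof
  assume eq: "c \<cdot>\<^sub>v x = 0\<^sub>v n"
  show "c = 0 \<or> x = 0\<^sub>v n"
  proof (rule ccontr)
    assume "\<not> ?thesis"
    then have "c \<noteq> 0" "x \<noteq> 0\<^sub>v n" by auto
    moreover have "inverse c \<cdot>\<^sub>v (c \<cdot>\<^sub>v x) = 0\<^sub>v n" using eq by simp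
    ultimately show False using assms by (simp add: smult_smult_assoc)
  qed
qed (use assms in auto)

lemma equiv_proj_rel: "equiv (carrier_vec (N + 1) - {0\<^sub>v (N + 1)}) (proj_rel N :: ('k::field vec \<times> 'k vec) set)"
proof (rule equivI)
  show "proj_rel N \<subseteq> (carrier_vec (N + 1) - {0\<^sub>v (N + 1)}) \<times> (carrier_vec (N + 1) - {0\<^sub>v (N + 1)})"
    by (auto simp: smult_vec_eq_0_iff)
  show "refl_on (carrier_vec (N + 1) - {0\<^sub>v (N + 1)}) (proj_rel N :: ('k vec \<times> 'k vec) set)"
    by (auto intro!: refl_onI exI[of _ 1])
  show "sym (proj_rel N :: ('k vec \<times> 'k vec) set)"
  proof (rule symI)
    fix x y :: "'k vec" assume "(x, y) \<in> proj_rel N"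
    then obtain c where c: "x \<in> carrier_vec (N + 1)" "x \<noteq> 0\<^sub>v (N + 1)" "c \<noteq> 0" "y = c \<cdot>\<^sub>v x" by auto
    then have "x = inverse c \<cdot>\<^sub>v y" "inverse c \<noteq> 0" by (auto simp: smult_smult_assoc)
    then have "\<exists>d. d \<noteq> 0 \<and> x = d \<cdot>\<^sub>v y" by blast
    then show "(y, x) \<in> proj_rel N" using c by (simp add: smult_vec_eq_0_iff)
  qed
  show "trans (proj_rel N :: ('k vec \<times> 'k vec) set)"
  proof (rule transI)
    fix x y z :: "'k vec" assume "(x, y) \<in> proj_rel N" "(y, z) \<in> proj_rel N"
    then obtain c d where "x \<in> carrier_vec (N + 1)" "x \<noteq> 0\<^sub>v (N + 1)" "c \<noteq> 0" "y = c \<cdot>\<^sub>v x"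
      "d \<noteq> 0" "z = d \<cdot>\<^sub>v y" by auto
    then show "(x, z) \<in> proj_rel N"
      by (auto simp: smult_smult_assoc intro!: exI[of _ "d * c"])
  qed
qed

lemma proj_class: "x \<in> carrier_vec (N + 1) - {0\<^sub>v (N + 1)} \<Longrightarrow> proj_rel N `` {x} = {c \<cdot>\<^sub>v x |c. c \<noteq> 0}"
  by auto

lemma proj_spaceE:
  assumes "P \<in> proj_space N"
  obtains x where "x \<in> carrier_vec (N + 1)" "x \<noteq> 0\<^sub>v (N + 1)" "P = {c \<cdot>\<^sub>v x |c. c \<noteq> 0}"
  using assms unfolding proj_space_def by (auto elim!: quotientE simp: proj_class)

lemma proj_spaceI:
  assumes "x \<in> carrier_vec (N + 1)" "x \<noteq> 0\<^sub>v (N + 1)"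
  shows "{c \<cdot>\<^sub>v x |c. c \<noteq> 0} \<in> proj_space N"
  using assms quotientI[of x _ "proj_rel N"] proj_class[of x N] unfolding proj_space_def by auto

text \<open>The classes are disjoint and equally large. The product form of the statement avoids
  division.\<close>

lemma card_proj_union:
  fixes \<P> :: "'k::{finite,field} vec set set"
  assumes "\<P> \<subseteq> proj_space N"
  shows "(CARD('k) - 1) * card \<P> = card (\<Union>\<P>)"
proof (rule card_partition)
  have "\<P> \<subseteq> Pow (carrier_vec (N + 1))"
    using assms by (fastforce elim: proj_spaceE)
  then show "finite \<P>" "finite (\<Union>\<P>)"
    using finite_subset[of \<P> "Pow (carrier_vec (N + 1))"] finite_subset[of "\<Union>\<P>" "carrier_vec (N + 1)"]
    by auto
  show "card P = CARD('k) - 1" if "P \<in> \<P>" for P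
    using that assms by (auto elim!: proj_spaceE simp: card_multiples dest!: subsetD)
  show "P \<inter> P' = {}" if "P \<in> \<P>" "P' \<in> \<P>" "P \<noteq> P'" for P P'
    using quotient_disj[OF equiv_proj_rel] that assms unfolding proj_space_def by blast
qed

lemma card_proj_space: "(CARD('k) - 1) * card (proj_space N :: 'k::{finite,field} vec set set) = CARD('k) ^ (N + 1) - 1"
proof -
  have "\<Union>(proj_space N :: 'k vec set set) = carrier_vec (N + 1) - {0\<^sub>v (N + 1)}"
    using Union_quotient[OF equiv_proj_rel] unfolding proj_space_def .
  then show ?thesis
    using card_proj_union[of "proj_space N :: 'k vec set set" N] 
    by (simp add: card_Diff_singleton card_carrier_vec)
qed

abbreviation val :: "'k::comm_ring_1 mpoly \<Rightarrow> 'k vec \<Rightarrow> 'k" where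
  "val F x \<equiv> peval id F (\<lambda>i. x $ i)"

definition in_vars :: "nat \<Rightarrow> 'k::comm_ring_1 mpoly \<Rightarrow> bool" where
  "in_vars n F \<longleftrightarrow> (\<forall>m\<in>Poly_Mapping.keys F. Poly_Mapping.keys m \<subseteq> {..<n})"

lemma hypersurface_iff: "hypersurface N d F \<longleftrightarrow> F \<noteq> 0 \<and> in_vars (Suc N) F \<and> homog d F"
  unfolding hypersurface_def in_vars_def homog_def mon_deg_def lessThan_Suc_atMost by blast

lemma peval_cong_vars:
  assumes "in_vars n F" "\<And>i. i < n \<Longrightarrow> x i = y i"
  shows "peval \<phi> F x = peval \<phi> F y"
  using assms by (intro peval_cong) (auto simp: in_vars_def)

lemma (in comm_ring_hom) peval_smult_vec:
  assumes "in_vars n F" "homog d F" "x \<in> carrier_vec n"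
  shows "peval hom F (\<lambda>i. (t \<cdot>\<^sub>v x) $ i) = t ^ d * peval hom F (\<lambda>i. x $ i)"
proof -
  have "peval hom F (\<lambda>i. (t \<cdot>\<^sub>v x) $ i) = peval hom F (\<lambda>i. t * x $ i)"
    using assms by (intro peval_cong_vars) auto
  then show ?thesis using assms by (simp add: peval_scale)
qed

text \<open>The union of the classes misses only the zero vector, which is a zero of the form since
  \<open>d > 0\<close>; this is the \<open>+ 1\<close>.\<close>

lemma card_proj_zeros:
  fixes F :: "'k::{finite,field} mpoly"
  assumes "in_vars (Suc N) F" "homog d F" "d > 0"
  shows "(CARD('k) - 1) * num_points N F + 1 = card {x \<in> carrier_vec (Suc N). val F x = 0}"
proof -
  have "\<Union>(proj_zeros id N F) = {x \<in> carrier_vec (Suc N). val F x = 0} - {0\<^sub>v (Suc N)}"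
  proof (intro equalityI subsetI)
    fix x assume "x \<in> \<Union>(proj_zeros id N F)"
    then obtain P where "P \<in> proj_space N" "x \<in> P" "val F x = 0" unfolding proj_zeros_def by auto
    then show "x \<in> {x \<in> carrier_vec (Suc N). val F x = 0} - {0\<^sub>v (Suc N)}"
      by (auto elim!: proj_spaceE simp: smult_vec_eq_0_iff)
  next
    fix x assume x: "x \<in> {x \<in> carrier_vec (Suc N). val F x = 0} - {0\<^sub>v (Suc N)}"
    then have "{c \<cdot>\<^sub>v x |c. c \<noteq> 0} \<in> proj_zeros id N F"
      using assms unfolding proj_zeros_def
      by (auto intro: proj_spaceI simp: id_hom.peval_smult_vec)
    moreover have "x \<in> {c \<cdot>\<^sub>v x |c. c \<noteq> 0}" by (auto intro!: exI[of _ 1])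
    ultimately show "x \<in> \<Union>(proj_zeros id N F)" by blast
  qed
  moreover have "val F (0\<^sub>v (Suc N)) = 0"
    using id_hom.peval_smult_vec[OF assms(1,2), of "0\<^sub>v (Suc N)" 0] assms(3)
    by (simp add: zero_power)
  moreover have "proj_zeros id N F \<subseteq> proj_space N" by (auto simp: proj_zeros_def)
  moreover have "finite {x \<in> carrier_vec (Suc N). val F x = 0}" by simp
  moreover from calculation have "card {x \<in> carrier_vec (Suc N). val F x = 0} > 0"
    by (auto simp: card_gt_0_iff)
  ultimately show ?thesis
    using card_proj_union[of "proj_zeros id N F" N] unfolding num_points_def
    by simp
qed

section \<open>Lines contained in a hypersurface\<close>

lemma (in comm_ring_hom) comm_ring_hom_map_poly: "comm_ring_hom (map_poly hom)"
proof
  show "map_poly hom (p * q) = map_poly hom p * map_poly hom q" for p q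
    by (rule poly_eqI) (simp add: coeff_map_poly coeff_mult hom_sum hom_mult)
  show "map_poly hom (p + q) = map_poly hom p + map_poly hom q" for p q
    by (rule poly_eqI) (simp add: coeff_map_poly hom_add)
  show "map_poly hom 1 = 1"
    by (simp add: map_poly_1)
qed simp

text \<open>Restriction to a rational line commutes with extension of scalars, so a formal identity
  over the base field persists over the closure.\<close>

lemma line_poly_to_ac:
  fixes F :: "'a::field mpoly"
  shows "line_poly to_ac F (\<lambda>i. to_ac (u i)) (\<lambda>i. to_ac (v i)) = map_poly to_ac (line_poly id F u v)"
proof -
  interpret M: comm_ring_hom "map_poly to_ac :: 'a poly \<Rightarrow> _"
    by (rule to_ac_hom.comm_ring_hom_map_poly)
  show ?thesis by (simp add: line_poly_def M.hom_peval map_poly_pCons)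
qed

lemma peval_to_ac: "peval to_ac F (\<lambda>i. to_ac (u i)) = to_ac (peval id F u)"
  by (simp add: to_ac_hom.hom_peval)

text \<open>For \<open>s \<noteq> 0\<close> homogeneity reduces to the parameter
  \<open>t / s\<close>; the remaining point lies at infinity of the parametrization, where the value
  is the top coefficient.\<close>

lemma peval_combination_zero:
  assumes F: "homog d F" and z: "line_poly id F u v = 0"
  shows "peval to_ac F (\<lambda>i. s * to_ac (u i) + t * to_ac (v i)) = 0"
proof -
  let ?u = "\<lambda>i. to_ac (u i)" and ?v = "\<lambda>i. to_ac (v i)"
  have lp: "line_poly to_ac F ?u ?v = 0" using z by (simp add: line_poly_to_ac)
  show ?thesis
  proof (cases "s = 0")
    case True
    have "peval to_ac F ?v = 0"
      using to_ac_hom.coeff_line_poly_top[OF F, of ?u ?v] lp by simp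
    then show ?thesis using True to_ac_hom.peval_scale[OF F, of t ?v] by simp
  next
    case False
    have "peval to_ac F (\<lambda>i. s * (?u i + t / s * ?v i)) = s ^ d * peval to_ac F (\<lambda>i. ?u i + t / s * ?v i)"
      by (rule to_ac_hom.peval_scale[OF F])
    also have "\<dots> = 0" using to_ac_hom.poly_line_poly[of F ?u ?v "t / s"] lp by simp
    finally show ?thesis using False by (simp add: distrib_left)
  qed
qed

definition subspace_dims :: "nat \<Rightarrow> 'k::field mpoly \<Rightarrow> nat set" where
  "subspace_dims N F = {h. \<exists>L. rational_subspace N h L \<and> L \<subseteq> proj_zeros to_ac N F}"

text \<open>Makes the set under \<open>Max\<close> in \<open>k_inv\<close> finite, so that the
  maximum is attained and is an upper bound.\<close>

lemma subspace_dims_le: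
  assumes "h \<in> subspace_dims N (F :: 'k::field mpoly)"
  shows "h \<le> N"
proof -
  interpret V: vec_space "TYPE('k)" "N + 1" .
  obtain B :: "'k vec set" where "B \<subseteq> carrier_vec (N + 1)" "card B = h + 1" "V.lin_indpt B"
    using assms unfolding subspace_dims_def rational_subspace_def by auto
  then show ?thesis using V.li_le_dim(2)[of B] V.fin_dim V.dim_is_n by simp
qed

lemma k_inv_eq_0:
  fixes F :: "'k::field mpoly"
  assumes "k_inv N F = 0"
  shows "0 \<in> subspace_dims N F" and "1 \<notin> subspace_dims N F"
proof -
  have fin: "finite (insert (-1) (int ` subspace_dims N F))"
    using subspace_dims_le by (auto intro!: finite_imageI finite_subset[of _ "{..N}"])
  have M: "Max (insert (-1) (int ` subspace_dims N F)) = 0"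
    using assms unfolding k_inv_def subspace_dims_def by simp
  have "0 \<in> insert (-1) (int ` subspace_dims N F)" using Max_in[OF fin] unfolding M by simp
  then show "0 \<in> subspace_dims N F" by auto
  have "\<not> (1 :: int) \<le> 0" by simp
  then show "1 \<notin> subspace_dims N F" using Max_ge[OF fin] M by (metis image_eqI insertI2 of_nat_1)
qed

text \<open>A rational subspace of dimension 0 is the class of one rational vector. The form
  vanishes there over the closure, hence over the base field because \<open>to_ac\<close> is
  injective.\<close>

lemma k_inv_eq_0_point:
  fixes F :: "'k::field mpoly"
  assumes "k_inv N F = 0" "in_vars (N + 1) F" "homog d F"
  obtains b where "b \<in> carrier_vec (N + 1)" "b \<noteq> 0\<^sub>v (N + 1)" "val F b = 0"
proof -
  interpret V: vec_space "TYPE('k)" "N + 1" .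
  interpret W: vec_space "TYPE('k alg_closure)" "N + 1" .
  have "0 \<in> subspace_dims N F" using k_inv_eq_0 assms by blast
  then obtain B :: "'k vec set" where B: "B \<subseteq> carrier_vec (N + 1)" "card B = 1" "V.lin_indpt B"
    and L: "{P \<in> proj_space N. P \<subseteq> W.span (map_vec to_ac ` B)} \<subseteq> proj_zeros to_ac N F"
    unfolding subspace_dims_def rational_subspace_def by auto
  obtain b where b: "B = {b}" using B(2) card_1_singletonE by blast
  have bc: "b \<in> carrier_vec (N + 1)" using B b by simp
  have "(1 :: 'k) \<noteq> 0" by simp
  then have "(UNIV :: 'k set) \<noteq> {0}" by blast
  then have b0: "b \<noteq> 0\<^sub>v (N + 1)" using V.zero_nin_lin_indpt[OF _ B(3)] B(1) b by auto
  let ?b = "map_vec to_ac b"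
  have bc': "?b \<in> carrier_vec (N + 1)" using bc by simp
  have b0': "?b \<noteq> 0\<^sub>v (N + 1)"
  proof
    assume z: "?b = 0\<^sub>v (N + 1)"
    have "b $ i = 0" if "i < N + 1" for i
      using arg_cong[OF z, of "\<lambda>x :: 'k alg_closure vec. x $ i"] that bc by simp
    then show False using b0 bc by (metis carrier_vecD eq_vecI index_zero_vec)
  qed
  have sp: "?b \<in> W.span {?b}" using W.in_own_span[of "{?b}"] bc' by simp
  have "{c \<cdot>\<^sub>v ?b |c. c \<noteq> 0} \<subseteq> W.span {?b}"
    using W.smult_in_span[of "{?b}" ?b] sp bc' by auto
  then have "{c \<cdot>\<^sub>v ?b |c. c \<noteq> 0} \<in> proj_zeros to_ac N F"
    using L proj_spaceI[OF bc' b0'] b by auto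
  moreover have "?b \<in> {c \<cdot>\<^sub>v ?b |c. c \<noteq> 0}" by (auto intro!: exI[of _ 1])
  ultimately have "peval to_ac F (\<lambda>i. ?b $ i) = 0" unfolding proj_zeros_def by blast
  moreover have "peval to_ac F (\<lambda>i. ?b $ i) = peval to_ac F (\<lambda>i. to_ac (b $ i))"
    using bc by (intro peval_cong_vars[OF assms(2)]) auto
  ultimately have "val F b = 0" by (simp add: peval_to_ac)
  with bc b0 show ?thesis by (rule that)
qed

text \<open>If the restriction vanished formally, the line spanned by \<open>u\<close> and
  \<open>v\<close> would lie in the hypersurface over the closure, giving a rational subspace of
  dimension 1. The absence of lines enters the whole argument through this lemma.\<close>

lemma line_poly_nonzero:
  fixes F :: "'k::field mpoly" and u v :: "'k vec"
  assumes k: "k_inv N F = 0" and F: "in_vars (N + 1) F" "homog d F"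
    and u: "u \<in> carrier_vec (N + 1)" "u \<noteq> 0\<^sub>v (N + 1)"
    and v: "v \<in> carrier_vec (N + 1)" "\<nexists>c. v = c \<cdot>\<^sub>v u"
  shows "line_poly id F (\<lambda>i. v $ i) (\<lambda>i. u $ i) \<noteq> 0"
proof
  assume z: "line_poly id F (\<lambda>i. v $ i) (\<lambda>i. u $ i) = 0"
  interpret V: vec_space "TYPE('k)" "N + 1" .
  interpret W: vec_space "TYPE('k alg_closure)" "N + 1" .
  let ?B = "{v, u}" and ?C = "map_vec to_ac ` {v, u} :: 'k alg_closure vec set"
  have uv: "v \<noteq> u" using v(2) by (metis one_smult_vec)
  have "V.lin_indpt ?B"
  proof (rule V.finite_lin_indpt2)
    fix a :: "'k vec \<Rightarrow> 'k" assume a: "V.lincomb a ?B = 0\<^sub>v (N + 1)"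
    have e: "a v * v $ i + a u * u $ i = 0" if "i < N + 1" for i
      using V.lincomb_index[OF that, of ?B a] u v uv a that by simp
    have "a v = 0"
    proof (rule ccontr)
      assume "a v \<noteq> 0"
      then have "v $ i = (- a u / a v) * u $ i" if "i < N + 1" for i
        using e[OF that] by (simp add: field_simps eq_neg_iff_add_eq_0)
      then have "v = (- a u / a v) \<cdot>\<^sub>v u" using u v by (intro eq_vecI) auto
      then show False using v(2) by blast
    qed
    moreover have "a u = 0"
    proof (rule ccontr)
      assume "a u \<noteq> 0"
      then have "u $ i = 0" if "i < N + 1" for i using e[OF that] \<open>a v = 0\<close> by simp
      then show False using u by (metis carrier_vecD eq_vecI index_zero_vec)
    qed
    ultimately show "\<forall>w\<in>?B. a w = 0" by simp
  qed (use u v in auto)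
  then have rs: "rational_subspace N 1 {P \<in> proj_space N. P \<subseteq> W.span ?C}"
    unfolding rational_subspace_def using u v uv by (intro exI[of _ ?B]) auto
  have "{P \<in> proj_space N. P \<subseteq> W.span ?C} \<subseteq> proj_zeros to_ac N F"
  proof (unfold proj_zeros_def, intro subsetI CollectI conjI ballI, simp)
    fix P x assume "P \<in> {P \<in> proj_space N. P \<subseteq> W.span ?C}" "x \<in> P"
    then have "x \<in> W.span ?C" by auto
    moreover have Cc: "?C \<subseteq> carrier_vec (N + 1)" using u v by auto
    ultimately obtain a where a: "x = W.lincomb a ?C" using W.finite_span[of ?C] by auto
    \<comment> \<open>Distinct images are needed for the combination over the image set to have two
      separate coefficients.\<close>
    have "map_vec to_ac v \<noteq> map_vec to_ac u"
    proof
      assume eq: "map_vec to_ac v = (map_vec to_ac u :: 'k alg_closure vec)"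
      have "v $ i = u $ i" if "i < N + 1" for i
        using arg_cong[OF eq, of "\<lambda>x :: 'k alg_closure vec. x $ i"] that u v by simp
      then show False using u v uv by (metis carrier_vecD eq_vecI)
    qed
    then have "x $ i = a (map_vec to_ac v) * to_ac (v $ i) + a (map_vec to_ac u) * to_ac (u $ i)"
      if "i < N + 1" for i
      using W.lincomb_index[OF that Cc, of a] that u v a by simp
    then have "peval to_ac F (\<lambda>i. x $ i) =
      peval to_ac F (\<lambda>i. a (map_vec to_ac v) * to_ac (v $ i) + a (map_vec to_ac u) * to_ac (u $ i))"
      by (intro peval_cong_vars[OF F(1)]) auto
    then show "peval to_ac F (\<lambda>i. x $ i) = 0" using peval_combination_zero[OF F(2) z] by simp
  qed
  with rs have "1 \<in> subspace_dims N F" unfolding subspace_dims_def by blast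
  then show False using k_inv_eq_0[OF k] by blast
qed

section \<open>Counting points along the lines through a rational point\<close>

text \<open>After division by the square of the variable the cofactor has degree two less, while
  only the single root 0 was removed.\<close>

lemma card_roots_double_root:
  fixes p :: "'a::idom poly"
  assumes "p \<noteq> 0" "coeff p 0 = 0" "coeff p 1 = 0"
  shows "card {x. poly p x = 0} + 1 \<le> degree p"
proof -
  obtain a b g where "p = pCons a (pCons b g)" by (metis pCons_cases)
  with assms have p: "p = pCons 0 (pCons 0 g)" and g: "g \<noteq> 0" by auto
  have "{x. poly p x = 0} = insert 0 {x. poly g x = 0}" by (auto simp: p)
  then have "card {x. poly p x = 0} \<le> Suc (card {x. poly g x = 0})"
    by (simp add: card_insert_le_m1 card_insert_if poly_roots_finite[OF g])
  also have "\<dots> \<le> Suc (degree g)" using card_poly_roots_bound[OF g] by simp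
  finally show ?thesis using g by (simp add: p)
qed

locale line_free_hypersurface =
  fixes F :: "'k::{finite,field} mpoly" and q n d :: nat
  assumes vars: "in_vars (n + 2) F" and homog: "homog d F" and d: "d \<ge> 2" and n: "n \<ge> 1"
    and q: "q = CARD('k)" and line_free: "k_inv (n + 1) F = 0"
begin

abbreviation V :: "'k vec set" where "V \<equiv> carrier_vec (n + 2)"

definition zeros :: "'k vec set" where "zeros = {x \<in> V. val F x = 0}"

definition T :: "'k vec \<Rightarrow> 'k vec \<Rightarrow> 'k" where
  "T b v = (\<Sum>i\<le>n + 1. v $ i * val (pderivative i F) b)"

text \<open>The point \<open>b\<close> is the direction, not the base point, so that every vector
  \<open>v\<close> contributes one parametrized line and \<open>b\<close> sits at infinity.\<close>

definition lp :: "'k vec \<Rightarrow> 'k vec \<Rightarrow> 'k poly" where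
  "lp v b = line_poly id F (\<lambda>i. v $ i) (\<lambda>i. b $ i)"

definition r :: "'k vec \<Rightarrow> 'k vec \<Rightarrow> nat" where
  "r b v = card {s. val F (v + s \<cdot>\<^sub>v b) = 0}"

lemma q_ge_2: "q \<ge> 2"
proof -
  have "card {0, 1 :: 'k} \<le> q" unfolding q by (rule card_mono) auto
  then show ?thesis by simp
qed

lemma poly_lp:
  assumes "v \<in> V" "b \<in> V"
  shows "poly (lp v b) s = val F (v + s \<cdot>\<^sub>v b)"
  unfolding lp_def id_hom.poly_line_poly using assms
  by (intro peval_cong_vars[OF vars]) auto

lemma r_lp: "v \<in> V \<Longrightarrow> b \<in> V \<Longrightarrow> r b v = card {s. poly (lp v b) s = 0}"
  by (simp add: r_def poly_lp)

lemma lp_coeffs: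
  "degree (lp v b) \<le> d" "coeff (lp v b) 0 = val F v" "coeff (lp v b) d = val F b"
  "coeff (lp v b) 1 = T v b" "coeff (lp v b) (d - 1) = T b v"
proof -
  have vars': "\<forall>m\<in>Poly_Mapping.keys F. Poly_Mapping.keys m \<subseteq> {..n + 1}"
    using vars unfolding in_vars_def by (simp add: lessThan_Suc_atMost)
  show T1: "coeff (lp v b) 1 = T v b" for v b
    unfolding lp_def T_def by (rule coeff_line_poly_1[OF id_hom.comm_ring_hom_axioms vars'])
  \<comment> \<open>Reversal turns this into the linear coefficient of \<open>lp b v\<close>, to
    which \<open>T1\<close> applies.\<close>
  show "coeff (lp v b) (d - 1) = T b v"
    using coeff_line_poly_swap[OF homog, of "d - 1" id "\<lambda>i. v $ i" "\<lambda>i. b $ i"] d T1[of b v]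
    by (simp add: lp_def)
qed (simp_all add: lp_def degree_line_poly homog id_hom.coeff_line_poly_0 id_hom.coeff_line_poly_top)

lemma lin_functional_T: "lin_functional V (T b)"
  unfolding lin_functional_def T_def sum_distrib_left sum.distrib[symmetric]
  by (intro conjI ballI allI sum.cong) (auto simp: algebra_simps)

text \<open>A case of Euler's relation. It is obtained without derivatives, since
  \<open>lp b b\<close> is (1 + t)^d times the value at \<open>b\<close>.\<close>

lemma T_self:
  assumes "val F b = 0"
  shows "T b b = 0"
proof -
  interpret C: comm_ring_hom "\<lambda>c :: 'k. [:id c:]" by (rule id_hom.comm_ring_hom_const_poly)
  have "lp b b = peval (\<lambda>c. [:id c:]) F (\<lambda>i. [:1, 1:] * [:b $ i:])"
    by (simp add: lp_def line_poly_def)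
  also have "\<dots> = [:1, 1:] ^ d * peval (\<lambda>c. [:id c:]) F (\<lambda>i. [:id (b $ i):])"
    by (subst C.peval_scale[OF homog]) simp
  also have "\<dots> = 0"
    using C.hom_peval[of id F "\<lambda>i. b $ i"] assms by (simp add: id_def)
  finally show ?thesis using lp_coeffs(4)[of b b] by simp
qed

lemma T_smult: "b \<in> V \<Longrightarrow> val F b = 0 \<Longrightarrow> T b (c \<cdot>\<^sub>v b) = 0"
  using lin_functional_T[of b] T_self[of b] unfolding lin_functional_def by auto

text \<open>The total of the pointwise bounds at a smooth point: \<open>q\<close> multiples of the
  point with \<open>q\<close> zeros each, the other \<open>q ^ (n + 1) - q\<close> tangent vectors
  with \<open>d - 2\<close>, and the nontangent vectors with \<open>d - 1\<close>.\<close>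

definition upper :: nat where
  "upper = q * q + (q ^ (n + 1) - q) * (d - 2) + (q ^ (n + 2) - q ^ (n + 1)) * (d - 1)"

context
  fixes b
  assumes b: "b \<in> V" "b \<noteq> 0\<^sub>v (n + 2)" "val F b = 0"
begin

lemma lp_nonzero: "v \<in> V \<Longrightarrow> \<nexists>c. v = c \<cdot>\<^sub>v b \<Longrightarrow> lp v b \<noteq> 0"
  unfolding lp_def using line_poly_nonzero[OF line_free _ homog, of b v] vars b by simp

lemma degree_lp_less: "degree (lp v b) \<le> d - 1"
  using lp_coeffs(1,3)[of v b] b d
  by (metis One_nat_def Suc_leI Suc_pred diff_is_0_eq' le_neq_implies_less leading_coeff_0_iff
      less_Suc_eq_le not_less_eq_eq degree_0 zero_le)

lemma degree_lp_tangent: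
  assumes "T b v = 0"
  shows "degree (lp v b) \<le> d - 2"
proof (rule degree_le, intro allI impI)
  fix i assume "d - 2 < i"
  then consider "i > d" | "i = d" | "i = d - 1" using d by linarith
  then show "coeff (lp v b) i = 0"
    using lp_coeffs(1,3,5)[of v b] b(3) assms by cases (auto intro: coeff_eq_0)
qed

lemma r_le:
  assumes "v \<in> V" "\<nexists>c. v = c \<cdot>\<^sub>v b"
  shows "r b v \<le> (if T b v = 0 then d - 2 else d - 1)"
  using card_poly_roots_bound[OF lp_nonzero[OF assms]] degree_lp_less[of v] degree_lp_tangent[of v]
  unfolding r_lp[OF assms(1) b(1)] by (auto intro: order_trans)

lemma r_multiple: "r b (c \<cdot>\<^sub>v b) = q"
proof -
  have "val F (c \<cdot>\<^sub>v b + s \<cdot>\<^sub>v b) = 0" for s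
    using b by (simp add: add_smult_distrib_vec[symmetric] id_hom.peval_smult_vec[OF vars homog])
  then show ?thesis by (simp add: r_def q)
qed

text \<open>The shear \<open>(v, s) \<mapsto> (s, v + s b)\<close> is a bijection of pairs; every
  zero is counted once for each shift \<open>s\<close>.\<close>

lemma sum_r: "(\<Sum>v\<in>V. r b v) = q * card zeros"
proof -
  have "(\<Sum>v\<in>V. r b v) = card (SIGMA v:V. {s. val F (v + s \<cdot>\<^sub>v b) = 0})"
    unfolding r_def by (subst card_SigmaI) auto
  also have "\<dots> = card ((UNIV :: 'k set) \<times> zeros)"
  proof (rule bij_betw_same_card[of "\<lambda>(v, s). (s, v + s \<cdot>\<^sub>v b)"],
      rule bij_betwI[where g = "\<lambda>(s, x). (x + (- s) \<cdot>\<^sub>v b, s)"])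
    have shift: "v + s \<cdot>\<^sub>v b + (- s) \<cdot>\<^sub>v b = v" "v + (- s) \<cdot>\<^sub>v b + s \<cdot>\<^sub>v b = v" if "v \<in> V" for v s
      using that b by (auto intro!: eq_vecI)
    show "(\<lambda>(v, s). (s, v + s \<cdot>\<^sub>v b)) \<in> (SIGMA v:V. {s. val F (v + s \<cdot>\<^sub>v b) = 0}) \<rightarrow> UNIV \<times> zeros"
      using b by (auto simp: zeros_def)
    show "(\<lambda>(s, x). (x + (- s) \<cdot>\<^sub>v b, s)) \<in> UNIV \<times> zeros \<rightarrow> (SIGMA v:V. {s. val F (v + s \<cdot>\<^sub>v b) = 0})"
    proof (rule Pi_I)
      fix y assume "y \<in> (UNIV :: 'k set) \<times> zeros"
      then obtain s x where y: "y = (s, x)" "x \<in> V" "val F x = 0" by (auto simp: zeros_def)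
      have "val F (x + (- s) \<cdot>\<^sub>v b + s \<cdot>\<^sub>v b) = 0" using y shift(2)[of x s] by simp
      then show "(\<lambda>(s, x). (x + (- s) \<cdot>\<^sub>v b, s)) y \<in> (SIGMA v:V. {s. val F (v + s \<cdot>\<^sub>v b) = 0})"
        using y b by simp
    qed
    show "(\<lambda>(s, x). (x + (- s) \<cdot>\<^sub>v b, s)) ((\<lambda>(v, s). (s, v + s \<cdot>\<^sub>v b)) y) = y"
      if "y \<in> (SIGMA v:V. {s. val F (v + s \<cdot>\<^sub>v b) = 0})" for y
      using that by (auto simp: shift)
    show "(\<lambda>(v, s). (s, v + s \<cdot>\<^sub>v b)) ((\<lambda>(s, x). (x + (- s) \<cdot>\<^sub>v b, s)) y) = y"
      if "y \<in> UNIV \<times> zeros" for y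
      using that by (auto simp: shift zeros_def)
  qed
  finally show ?thesis by (simp add: card_cartesian_product q)
qed

definition g :: "'k vec \<Rightarrow> nat" where
  "g v = (if \<exists>c. v = c \<cdot>\<^sub>v b then q else if T b v = 0 then d - 2 else d - 1)"

lemma r_le_g: "v \<in> V \<Longrightarrow> r b v \<le> g v"
  using r_le[of v] r_multiple by (auto simp: g_def)

text \<open>The size \<open>k\<close> of the tangent space is left open to treat smooth and singular
  points together. The inequality \<open>q \<le> k\<close> justifies the subtraction
  \<open>k - q\<close>.\<close>

lemma sum_g:
  assumes K: "card {v \<in> V. T b v = 0} = k"
  shows "(\<Sum>v\<in>V. g v) = q * q + (k - q) * (d - 2) + (q ^ (n + 2) - k) * (d - 1)" and "q \<le> k"
proof -
  let ?M = "{c \<cdot>\<^sub>v b |c. True}" and ?K = "{v \<in> V. T b v = 0}"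
  have M: "?M \<subseteq> ?K" using b T_smult by auto
  have fin: "finite ?K" "finite V" by auto
  have finM: "finite ?M" using M fin(1) by (rule finite_subset)
  have cM: "card ?M = q" using card_multiples(1)[OF b(1,2), folded q] .
  show "q \<le> k" using card_mono[OF fin(1) M] cM K by simp
  have "(\<Sum>v\<in>V. g v) = (\<Sum>v\<in>?K. g v) + (\<Sum>v\<in>V - ?K. g v)"
    by (subst sum.subset_diff[of ?K V]) auto
  also have "(\<Sum>v\<in>?K. g v) = (\<Sum>v\<in>?M. g v) + (\<Sum>v\<in>?K - ?M. g v)"
    by (subst sum.subset_diff[OF M fin(1)]) auto
  also have "(\<Sum>v\<in>?M. g v) = (\<Sum>v\<in>?M. q)"
    by (intro sum.cong) (auto simp: g_def)
  also have "(\<Sum>v\<in>?K - ?M. g v) = (\<Sum>v\<in>?K - ?M. d - 2)"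
    by (intro sum.cong) (auto simp: g_def)
  also have "(\<Sum>v\<in>V - ?K. g v) = (\<Sum>v\<in>V - ?K. d - 1)"
    using M by (intro sum.cong) (auto simp: g_def)
  also have "(\<Sum>v\<in>?M. q) = q * q" using cM by simp
  also have "(\<Sum>v\<in>?K - ?M. d - 2) = (k - q) * (d - 2)"
    using card_Diff_subset[OF finM M] cM K by simp
  also have "(\<Sum>v\<in>V - ?K. d - 1) = (q ^ (n + 2) - k) * (d - 1)"
    using card_Diff_subset[OF fin(1), of V] K by (simp add: card_carrier_vec q)
  finally show "(\<Sum>v\<in>V. g v) = q * q + (k - q) * (d - 2) + (q ^ (n + 2) - k) * (d - 1)" by simp
qed

lemma card_kernel_T:
  assumes "\<exists>v\<in>V. T b v \<noteq> 0"
  shows "card {v \<in> V. T b v = 0} = q ^ (n + 1)"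
proof -
  obtain v where "v \<in> V" "T b v \<noteq> 0" using assms by blast
  from card_kernel[OF vec_subspace_carrier lin_functional_T this] q_ge_2
  show ?thesis by (simp add: card_carrier_vec q[symmetric])
qed

lemma sum_g_smooth: "\<exists>v\<in>V. T b v \<noteq> 0 \<Longrightarrow> (\<Sum>v\<in>V. g v) = upper"
  using sum_g[OF card_kernel_T] by (simp add: upper_def)

text \<open>At a singular point every direction is tangent, so
  \<open>q ^ (n + 2) - q ^ (n + 1)\<close> vectors each contribute one less than at a smooth
  point.\<close>

lemma sum_g_singular:
  assumes "\<forall>v\<in>V. T b v = 0"
  shows "(\<Sum>v\<in>V. g v) < upper"
proof -
  have "{v \<in> V. T b v = 0} = V" using assms by auto
  then have k: "card {v \<in> V. T b v = 0} = q ^ (n + 2)" by (simp add: card_carrier_vec q)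
  have 1: "q ^ (n + 1) < q ^ (n + 2)" using q_ge_2 by simp
  have 2: "q ^ 1 \<le> q ^ (n + 1)" using q_ge_2 by (intro power_increasing) auto
  define x y z where "x = q ^ (n + 2) - q ^ (n + 1)" "y = q ^ (n + 1) - q" "z = d - 2"
  have xy: "q ^ (n + 2) - q = x + y" "x > 0" "d - 1 = Suc z" using 1 2 d by (simp_all add: x_y_z_def)
  show ?thesis unfolding sum_g(1)[OF k] upper_def xy(1,3) x_y_z_def[symmetric]
    using xy(2) by (simp add: algebra_simps)
qed

lemma sum_r_le: "q * card zeros \<le> upper"
proof -
  have "(\<Sum>v\<in>V. r b v) \<le> (\<Sum>v\<in>V. g v)" using r_le_g by (rule sum_mono)
  then show ?thesis using sum_r sum_g_smooth sum_g_singular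
    by (metis less_imp_le_nat order_trans order.refl)
qed

text \<open>Equality of totals forces equality in each term, and the strictly smaller total at a
  singular point excludes that case.\<close>

lemma sum_r_eq:
  assumes "q * card zeros = upper"
  shows "\<exists>v\<in>V. T b v \<noteq> 0" and "v \<in> V \<Longrightarrow> r b v = g v"
proof -
  have le: "(\<Sum>v\<in>V. r b v) \<le> (\<Sum>v\<in>V. g v)" using r_le_g by (rule sum_mono)
  then have "\<not> (\<Sum>v\<in>V. g v) < upper" using sum_r assms by simp
  then show ex: "\<exists>v\<in>V. T b v \<noteq> 0" using sum_g_singular by blast
  then have eq: "(\<Sum>v\<in>V. r b v) = (\<Sum>v\<in>V. g v)" using sum_g_smooth sum_r assms by simp
  show "r b v = g v" if "v \<in> V"
    using sum_mono_inv[OF eq r_le_g that] by simp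
qed

text \<open>For \<open>d = 2\<close> the bounds are attained automatically: it is 0 for tangent
  vectors that are not multiples of \<open>b\<close>, and for nontangent ones the restriction has
  degree exactly 1, hence exactly one root.\<close>

lemma sum_r_smooth_quadric:
  assumes "d = 2" "\<exists>v\<in>V. T b v \<noteq> 0"
  shows "q * card zeros = upper"
proof -
  have "r b v = g v" if v: "v \<in> V" for v
  proof (cases "T b v = 0")
    case True
    show ?thesis
    proof (cases "\<exists>c. v = c \<cdot>\<^sub>v b")
      case True
      then show ?thesis using r_multiple by (auto simp: g_def)
    next
      case False
      then have "g v = 0" unfolding g_def using \<open>T b v = 0\<close> assms(1) by simp
      then show ?thesis using r_le_g[OF v] by simp
    qed
  next
    case False
    then have nc: "\<nexists>c. v = c \<cdot>\<^sub>v b" using T_smult b by auto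
    have "degree (lp v b) \<le> 1" using degree_lp_less[of v] assms by simp
    moreover have c1: "coeff (lp v b) 1 \<noteq> 0" using lp_coeffs(5)[of v b] assms False by simp
    ultimately obtain a where l: "lp v b = [:a, coeff (lp v b) 1:]"
      using degree1_coeffs[of "lp v b"] le_degree[OF c1] by (metis coeff_pCons_0 coeff_pCons_Suc One_nat_def le_antisym)
    have "poly (lp v b) (- a / coeff (lp v b) 1) = 0" using c1 by (subst l) (simp del: coeff_pCons_Suc)
    then have "r b v \<noteq> 0" unfolding r_lp[OF v b(1)] by (auto simp: card_eq_0_iff)
    moreover have "g v = 1" unfolding g_def using nc False assms(1) by simp
    ultimately show ?thesis using r_le_g[OF v] by simp
  qed
  then show ?thesis using sum_g_smooth[OF assms(2)] sum_r by simp
qed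

end

lemma rational_point:
  obtains b where "b \<in> V" "b \<noteq> 0\<^sub>v (n + 2)" "val F b = 0"
  using k_inv_eq_0_point[OF line_free _ homog] vars by auto

text \<open>The same line is counted from \<open>b\<close> and from \<open>Q\<close>. Equality from
  both ends makes it tangent at both, so the restriction has degree at most \<open>d - 2\<close> and
  a double root, which leaves at most \<open>d - 3\<close> distinct roots where \<open>d - 2\<close>
  are required.\<close>

lemma equality_degree:
  assumes eq: "q * card zeros = upper"
  shows "d = 2"
proof (rule ccontr)
  assume "d \<noteq> 2"
  then have d3: "d \<ge> 3" using d by simp
  obtain b where b: "b \<in> V" "b \<noteq> 0\<^sub>v (n + 2)" "val F b = 0" by (rule rational_point)
  let ?M = "{c \<cdot>\<^sub>v b |c. True}" and ?K = "{v \<in> V. T b v = 0}"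
  have "card ?M < card ?K"
  proof -
    \<comment> \<open>Here \<open>n \<ge> 1\<close> enters: the tangent space at \<open>b\<close> is
      larger than the multiples of \<open>b\<close>.\<close>
    have "q ^ 1 < q ^ (n + 1)" using q_ge_2 n by (intro power_strict_increasing) auto
    then show ?thesis
      using card_kernel_T[OF b] sum_r_eq(1)[OF b eq] card_multiples(1)[OF b(1,2), folded q] by simp
  qed
  then have "\<not> ?K \<subseteq> ?M"
  proof -
    have "?M \<subseteq> V" using b by auto
    then have "finite ?M" by (rule finite_subset) simp
    with \<open>card ?M < card ?K\<close> show ?thesis using card_mono[of ?M ?K] by linarith
  qed
  then obtain w where w: "w \<in> V" "T b w = 0" "\<nexists>c. w = c \<cdot>\<^sub>v b" by blast
  have "r b w = d - 2" using sum_r_eq(2)[OF b eq w(1)] w by (simp add: g_def[OF b])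
  then have "card {s. val F (w + s \<cdot>\<^sub>v b) = 0} \<noteq> 0" using d3 by (simp add: r_def)
  then have "{s. val F (w + s \<cdot>\<^sub>v b) = 0} \<noteq> {}" by (metis card.empty)
  then obtain s where s: "val F (w + s \<cdot>\<^sub>v b) = 0" by auto
  define Q where "Q = w + s \<cdot>\<^sub>v b"
  have Q: "Q \<in> V" "val F Q = 0" using w b s by (simp_all add: Q_def)
  have Qb: "\<nexists>c. Q = c \<cdot>\<^sub>v b"
  proof
    assume "\<exists>c. Q = c \<cdot>\<^sub>v b"
    then obtain c where "Q = c \<cdot>\<^sub>v b" by blast
    then have "w = (c - s) \<cdot>\<^sub>v b"
      using w(1) b(1) unfolding Q_def by (intro eq_vecI) (auto simp: vec_eq_iff algebra_simps)
    then show False using w(3) by blast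
  qed
  have Q0: "Q \<noteq> 0\<^sub>v (n + 2)"
    using Qb b(1) by (metis smult_vec_eq_0_iff)
  have bQ: "\<nexists>c. b = c \<cdot>\<^sub>v Q"
  proof
    assume "\<exists>c. b = c \<cdot>\<^sub>v Q"
    then obtain c where c: "b = c \<cdot>\<^sub>v Q" by blast
    then have "c \<noteq> 0" using b Q by auto
    then have "Q = inverse c \<cdot>\<^sub>v b" using c by (simp add: smult_smult_assoc)
    then show False using Qb by blast
  qed
  have "T b Q = T b w + s * T b b"
    unfolding Q_def using lin_functional_T[of b] w b by (simp add: lin_functional_def)
  then have TbQ: "T b Q = 0" using w T_self[OF b(3)] by simp
  have rbQ: "r b Q = d - 2" using sum_r_eq(2)[OF b eq Q(1)] Qb TbQ by (simp add: g_def[OF b])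
  \<comment> \<open>Changing the base point of the line inverts the parameter. The convention
    \<open>inverse 0 = 0\<close> is what makes this cover \<open>t = 0\<close>: it matches the zero
    at \<open>Q\<close> with the zero at \<open>b\<close>, each of which is the point at infinity
    for the other parametrization.\<close>
  have swap: "val F (b + inverse t \<cdot>\<^sub>v Q) = 0" if "val F (Q + t \<cdot>\<^sub>v b) = 0" "b \<in> V" "Q \<in> V" "val F b = 0" for b Q t
  proof (cases "t = 0")
    case True
    have "b + 0 \<cdot>\<^sub>v Q = b" using that by (intro eq_vecI) auto
    then show ?thesis using that True by simp
  next
    case False
    then have "b + inverse t \<cdot>\<^sub>v Q = inverse t \<cdot>\<^sub>v (Q + t \<cdot>\<^sub>v b)"
      using that by (intro eq_vecI) (auto simp: field_simps)
    moreover have "Q + t \<cdot>\<^sub>v b \<in> V" using that by simp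
    ultimately show ?thesis using that(1) id_hom.peval_smult_vec[OF vars homog] by simp
  qed
  have "{t. val F (b + t \<cdot>\<^sub>v Q) = 0} = inverse ` {t. val F (Q + t \<cdot>\<^sub>v b) = 0}"
  proof (intro equalityI subsetI)
    fix t assume "t \<in> {t. val F (b + t \<cdot>\<^sub>v Q) = 0}"
    then have "inverse t \<in> {t. val F (Q + t \<cdot>\<^sub>v b) = 0}" using swap[of b t Q] b Q by simp
    then show "t \<in> inverse ` {t. val F (Q + t \<cdot>\<^sub>v b) = 0}" by (metis imageI inverse_inverse_eq)
  qed (use swap[of Q _ b] b Q in auto)
  then have "r Q b = r b Q"
    unfolding r_def by (simp add: card_image inj_on_def)
  \<comment> \<open>The bound at \<open>Q\<close> in direction \<open>b\<close> is attained and
    equals \<open>d - 2\<close>, a value that only tangent directions have.\<close>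
  then have "T Q b = 0"
    using sum_r_eq(2)[OF Q(1) Q0 Q(2) eq b(1)] bQ rbQ d3 by (auto simp: g_def[OF Q(1) Q0 Q(2)] split: if_splits)
  then have "card {x. poly (lp Q b) x = 0} + 1 \<le> degree (lp Q b)"
    using lp_coeffs(2,4)[of Q b] Q by (intro card_roots_double_root lp_nonzero[OF b Q(1) Qb]) auto
  then show False
    using rbQ degree_lp_tangent[OF b TbQ] d3 unfolding r_lp[OF Q(1) b(1)] by simp
qed

text \<open>Translates the total into the projective bound: m points correspond to
  \<open>(q - 1) * m + 1\<close> vectors in the cone, each counted \<open>q\<close> times.\<close>

lemma upper_eq: "upper = q * ((q - 1) * ((d - 1) * q ^ n + (d - 2) * card (proj_space (n - 1) :: 'k vec set set) + 1) + 1)"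
proof -
  \<comment> \<open>Writing \<open>q\<close> as \<open>Suc e\<close> and \<open>d\<close> as
    \<open>z + 2\<close> removes the truncated subtractions.\<close>
  obtain e where e: "q = Suc e" "e > 0" using q_ge_2 by (cases q) auto
  let ?P = "card (proj_space (n - 1) :: 'k vec set set)"
  have "(q - 1) * ?P = q ^ n - 1" using card_proj_space[of "n - 1", where ?'k = 'k] n by (simp add: q)
  then have P: "q ^ n = e * ?P + 1" using e by (metis Suc_eq_plus1 diff_Suc_1 Suc_pred' zero_less_Suc zero_less_power)
  obtain z where z: "d = z + 2" using d by (metis add.commute le_Suc_ex)
  define p where "p = ?P"
  have qx: "q * x = e * x + x" for x using e(1) by simp
  have "q ^ (n + 1) = q * (e * p) + q" using P by (simp add: p_def algebra_simps)
  then have 1: "q ^ (n + 1) - q = q * (e * p)" by simp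
  have "q ^ (n + 2) = e * q ^ (n + 1) + q ^ (n + 1)" using qx[of "q ^ (n + 1)"] by simp
  then have 2: "q ^ (n + 2) - q ^ (n + 1) = e * (q * q ^ n)" by simp
  have 3: "d - 2 = z" "d - 1 = z + 1" "q - 1 = e" using z e by simp_all
  show ?thesis unfolding upper_def p_def[symmetric] 1 2 3 qx[of q] by (simp add: algebra_simps)
qed

lemma scaled_le_iff: "q * ((q - 1) * a + 1) \<le> q * ((q - 1) * b + 1) \<longleftrightarrow> a \<le> b"
  and scaled_eq_iff: "q * ((q - 1) * a + 1) = q * ((q - 1) * b + 1) \<longleftrightarrow> a = b"
  using q_ge_2 by simp_all

lemma card_zeros: "card zeros = (q - 1) * num_points (n + 1) F + 1"
  using card_proj_zeros[of "n + 1" F d] vars homog d by (simp add: zeros_def q)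

lemma num_points_le: "num_points (n + 1) F \<le> (d - 1) * q ^ n + (d - 2) * card (proj_space (n - 1) :: 'k vec set set) + 1"
proof -
  obtain b where b: "b \<in> V" "b \<noteq> 0\<^sub>v (n + 2)" "val F b = 0" by (rule rational_point)
  show ?thesis using sum_r_le[OF b] unfolding upper_eq card_zeros scaled_le_iff .
qed

lemma num_points_eq_iff: "num_points (n + 1) F = (d - 1) * q ^ n + (d - 2) * card (proj_space (n - 1) :: 'k vec set set) + 1 \<longleftrightarrow> q * card zeros = upper"
  unfolding upper_eq card_zeros scaled_eq_iff ..

end

section \<open>Polarization of quadratic forms\<close>

lemma mon_deg_add: "mon_deg (m + m') = mon_deg m + mon_deg m'"
proof -
  let ?S = "Poly_Mapping.keys m \<union> Poly_Mapping.keys m'"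
  have "Poly_Mapping.keys (m + m') \<subseteq> ?S" by (rule Poly_Mapping.keys_add)
  then show ?thesis by (simp add: mon_deg_superset[of ?S] lookup_add sum.distrib)
qed

lemma mon_deg_single [simp]: "mon_deg (Poly_Mapping.single i e) = e"
  by (cases "e = 0") (simp_all add: mon_deg_def)

lemma mon_deg_eq_0_iff [simp]: "mon_deg m = 0 \<longleftrightarrow> m = 0"
proof
  assume "mon_deg m = 0"
  then have "\<forall>i\<in>Poly_Mapping.keys m. Poly_Mapping.lookup m i = 0" by (simp add: mon_deg_def)
  then show "m = 0" by (intro poly_mapping_eqI) (auto simp: in_keys_iff)
qed (simp add: mon_deg_def)

lemma mon_deg_SucE:
  assumes "mon_deg m = Suc k"
  obtains i m' where "m = Poly_Mapping.single i 1 + m'" "mon_deg m' = k"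
proof -
  have "mon_deg m \<noteq> 0" using assms by simp
  then have "m \<noteq> 0" by simp
  then obtain i where "Poly_Mapping.lookup m i \<noteq> 0" by (metis poly_mapping_eqI lookup_zero)
  then have m: "m = Poly_Mapping.single i 1 + (m - Poly_Mapping.single i 1)"
    by (intro poly_mapping_eqI) (auto simp: lookup_add lookup_minus lookup_single when_def)
  then have "mon_deg m = 1 + mon_deg (m - Poly_Mapping.single i 1)"
    by (metis mon_deg_add mon_deg_single)
  with m assms that show ?thesis by simp
qed

lemma mon_deg_2E:
  assumes "mon_deg m = 2"
  obtains i j where "m = Poly_Mapping.single i 1 + Poly_Mapping.single j 1"
proof -
  obtain i m' where m: "m = Poly_Mapping.single i 1 + m'" "mon_deg m' = 1"
    using assms mon_deg_SucE[of m 1] by (auto simp: numeral_2_eq_2)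
  then obtain j m'' where "m' = Poly_Mapping.single j 1 + m''" "mon_deg m'' = 0"
    using mon_deg_SucE[of m' 0] by auto
  with m that show ?thesis by auto
qed

text \<open>Contains no factor 1/2, so it makes sense in characteristic two. A free coefficient map
  serves the base field, its closure and polynomial substitution alike.\<close>

definition polar ::
  "('a::comm_ring_1 \<Rightarrow> 'b::comm_ring_1) \<Rightarrow> 'a mpoly \<Rightarrow> (nat \<Rightarrow> 'b) \<Rightarrow> (nat \<Rightarrow> 'b) \<Rightarrow> 'b" where
  "polar \<phi> F x y = peval \<phi> F (\<lambda>i. x i + y i) - peval \<phi> F x - peval \<phi> F y"

lemma polar_commute: "polar \<phi> F x y = polar \<phi> F y x"
  by (simp add: polar_def add.commute)

lemma peval_add_vars: "peval \<phi> F (\<lambda>i. x i + y i) = peval \<phi> F x + peval \<phi> F y + polar \<phi> F x y"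
  by (simp add: polar_def)

lemma polar_monomials: "polar \<phi> F x y = (\<Sum>m\<in>Poly_Mapping.keys F. \<phi> (Poly_Mapping.lookup F m) *
    (mon_val m (\<lambda>i. x i + y i) - mon_val m x - mon_val m y))"
  by (simp add: polar_def peval_eq sum_subtractf right_diff_distrib)

text \<open>The indices may coincide. The right side is visibly bilinear, and bilinearity for
  quadratic forms follows monomial by monomial.\<close>

lemma polar_mon:
  "mon_val (Poly_Mapping.single i 1 + Poly_Mapping.single j 1) (\<lambda>i. x i + y i)
     - mon_val (Poly_Mapping.single i 1 + Poly_Mapping.single j 1) x
     - mon_val (Poly_Mapping.single i 1 + Poly_Mapping.single j 1) y
   = x i * y j + y i * x j"
  by (simp add: mon_val_add algebra_simps)

lemma polar_add_left:
  assumes "homog 2 F"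
  shows "polar \<phi> F (\<lambda>i. x i + x' i) y = polar \<phi> F x y + polar \<phi> F x' y"
  unfolding polar_monomials sum.distrib[symmetric]
proof (rule sum.cong[OF refl])
  fix m assume "m \<in> Poly_Mapping.keys F"
  then obtain i j where m: "m = Poly_Mapping.single i 1 + Poly_Mapping.single j 1"
    using assms mon_deg_2E unfolding homog_def by blast
  show "\<phi> (Poly_Mapping.lookup F m) *
      (mon_val m (\<lambda>i. x i + x' i + y i) - mon_val m (\<lambda>i. x i + x' i) - mon_val m y) =
    \<phi> (Poly_Mapping.lookup F m) * (mon_val m (\<lambda>i. x i + y i) - mon_val m x - mon_val m y) +
    \<phi> (Poly_Mapping.lookup F m) * (mon_val m (\<lambda>i. x' i + y i) - mon_val m x' - mon_val m y)"
    unfolding m polar_mon by (simp add: algebra_simps)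
qed

lemma polar_scale_left:
  assumes "homog 2 F"
  shows "polar \<phi> F (\<lambda>i. t * x i) y = t * polar \<phi> F x y"
  unfolding polar_monomials sum_distrib_left
proof (rule sum.cong[OF refl])
  fix m assume "m \<in> Poly_Mapping.keys F"
  then obtain i j where m: "m = Poly_Mapping.single i 1 + Poly_Mapping.single j 1"
    using assms mon_deg_2E unfolding homog_def by blast
  show "\<phi> (Poly_Mapping.lookup F m) *
      (mon_val m (\<lambda>i. t * x i + y i) - mon_val m (\<lambda>i. t * x i) - mon_val m y) =
    t * (\<phi> (Poly_Mapping.lookup F m) * (mon_val m (\<lambda>i. x i + y i) - mon_val m x - mon_val m y))"
    unfolding m polar_mon by (simp add: algebra_simps)
qed

lemma polar_scale_right: "homog 2 F \<Longrightarrow> polar \<phi> F y (\<lambda>i. t * x i) = t * polar \<phi> F y x"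
  using polar_scale_left polar_commute by metis

context comm_ring_hom
begin

lemma hom_polar: "hom (polar \<phi> F x y) = polar (\<lambda>c. hom (\<phi> c)) F (\<lambda>i. hom (x i)) (\<lambda>i. hom (y i))"
  by (simp add: polar_def hom_minus hom_peval hom_add)

lemma polar_self:
  assumes "homog 2 F"
  shows "polar hom F x x = 2 * peval hom F x"
  using peval_scale[OF assms, of 2 x] by (simp add: polar_def algebra_simps)

text \<open>For quadrics this identifies the differential with the polar form, again without
  dividing by 2.\<close>

lemma coeff_line_poly_polar:
  assumes "homog 2 F"
  shows "coeff (line_poly hom F u v) 1 = polar hom F u v"
proof -
  interpret C: comm_ring_hom "\<lambda>c. [:hom c:]" by (rule comm_ring_hom_const_poly)
  interpret D: comm_ring_hom "\<lambda>c :: 'b. [:c:]" by unfold_locales (simp_all add: one_pCons)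
  let ?X = "[:0, 1:]"
  have "line_poly hom F u v = peval (\<lambda>c. [:hom c:]) F (\<lambda>i. [:u i:] + ?X * [:v i:])"
    by (simp add: line_poly_def)
  also have "\<dots> = [:peval hom F u:] + ?X ^ 2 * [:peval hom F v:] + ?X * [:polar hom F u v:]"
    unfolding peval_add_vars C.peval_scale[OF assms] polar_scale_right[OF assms]
    by (simp add: D.hom_peval D.hom_polar)
  finally show ?thesis by (simp add: power2_eq_square)
qed

text \<open>The scalars \<open>y0\<close>, \<open>y1\<close>, \<open>y2\<close> live in the target
  ring: for \<open>hom = Const\<close> they can be variables, and the identity describes a change of
  coordinates.\<close>

lemma peval_linear_combination3:
  assumes "homog 2 F"
  shows "peval hom F (\<lambda>i. y0 * hom (a i) + y1 * hom (b i) + y2 * hom (c i)) =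
    hom (peval id F a) * y0 ^ 2 + hom (peval id F b) * y1 ^ 2 + hom (peval id F c) * y2 ^ 2 +
    hom (polar id F a b) * y0 * y1 + hom (polar id F a c) * y0 * y2 + hom (polar id F b c) * y1 * y2"
  unfolding peval_add_vars peval_scale[OF assms] polar_add_left[OF assms]
    polar_scale_left[OF assms] polar_scale_right[OF assms]
  by (simp add: hom_peval hom_polar algebra_simps)

lemma peval_linear_combination4:
  assumes "homog 2 F"
  shows "peval hom F (\<lambda>i. y0 * hom (a i) + y1 * hom (b i) + y2 * hom (c i) + y3 * hom (e i)) =
    hom (peval id F a) * y0 ^ 2 + hom (peval id F b) * y1 ^ 2 + hom (peval id F c) * y2 ^ 2 +
    hom (peval id F e) * y3 ^ 2 +
    hom (polar id F a b) * y0 * y1 + hom (polar id F a c) * y0 * y2 + hom (polar id F b c) * y1 * y2 +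
    hom (polar id F a e) * y0 * y3 + hom (polar id F b e) * y1 * y3 + hom (polar id F c e) * y2 * y3"
  unfolding peval_add_vars peval_scale[OF assms] polar_add_left[OF assms]
    polar_scale_left[OF assms] polar_scale_right[OF assms]
  by (simp add: hom_peval hom_polar algebra_simps)

end

section \<open>Finite fields\<close>

text \<open>More than half of the field elements are squares, so the values of the first term and
  the differences of \<open>c\<close> and the second term must meet.\<close>

lemma binary_diagonal_universal:
  fixes \<gamma> \<delta> c :: "'k::{finite,field}"
  assumes "\<gamma> \<noteq> 0" "\<delta> \<noteq> 0"
  obtains x y where "\<gamma> * x ^ 2 + \<delta> * y ^ 2 = c"
proof -
  have half: "CARD('k) + 1 \<le> 2 * card (range (\<lambda>x :: 'k. x ^ 2))"
  proof -
    let ?S = "range (\<lambda>x :: 'k. x ^ 2)"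
    have fib: "card {x :: 'k. x ^ 2 = a} \<le> 2" if a: "a \<in> ?S" for a
    proof -
      obtain z where "a = z ^ 2" using a by auto
      then have "{x. x ^ 2 = a} \<subseteq> {z, - z}" by (auto simp: power2_eq_iff)
      then have "card {x. x ^ 2 = a} \<le> card {z, - z}" by (rule card_mono[rotated]) simp
      also have "\<dots> \<le> 2" by (simp add: card_insert_le_m1)
      finally show ?thesis .
    qed
    have "CARD('k) = card (\<Union>a\<in>?S. {x. x ^ 2 = a})"
      by (rule arg_cong[where f = card]) auto
    also have "\<dots> \<le> (\<Sum>a\<in>?S. card {x :: 'k. x ^ 2 = a})"
      by (rule card_UN_le) simp
    \<comment> \<open>The fibre over 0 has one element instead of two; this gives the strict
      majority needed for the pigeonhole argument.\<close>
    also have "\<dots> = card {x :: 'k. x ^ 2 = 0} + (\<Sum>a\<in>?S - {0}. card {x :: 'k. x ^ 2 = a})"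
      by (rule sum.remove) (auto intro: rev_image_eqI[of 0])
    also have "\<dots> \<le> 1 + (\<Sum>a\<in>?S - {0}. 2)"
      using fib by (intro add_mono sum_mono) auto
    also have "\<dots> = 1 + 2 * (card ?S - 1)"
      by (subst sum_constant, subst card_Diff_singleton) (auto intro: rev_image_eqI[of 0])
    finally have "CARD('k) \<le> 1 + 2 * (card ?S - 1)" .
    moreover have "card ?S > 0" by (simp add: card_gt_0_iff)
    ultimately show ?thesis by linarith
  qed
  let ?A = "(\<lambda>s. \<gamma> * s) ` range (\<lambda>x. x ^ 2)" and ?B = "(\<lambda>s. c - \<delta> * s) ` range (\<lambda>x. x ^ 2)"
  have "card ?A = card (range (\<lambda>x :: 'k. x ^ 2))" "card ?B = card (range (\<lambda>x :: 'k. x ^ 2))"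
    using assms by (auto intro!: card_image inj_onI)
  then have "card ?A + card ?B > CARD('k)" using half by linarith
  moreover have "card (?A \<union> ?B) + card (?A \<inter> ?B) = card ?A + card ?B"
    by (rule card_Un_Int[symmetric]) auto
  moreover have "card (?A \<union> ?B) \<le> CARD('k)" by (rule card_mono) auto
  ultimately have "?A \<inter> ?B \<noteq> {}" by (metis add.right_neutral card.empty not_less)
  then obtain x y where "\<gamma> * x ^ 2 = c - \<delta> * y ^ 2" by auto
  then show ?thesis by (intro that[of x y]) (simp add: algebra_simps)
qed

section \<open>Parity of the order, and squares and the trace in characteristic two\<close>

lemma of_nat_card_eq_0: "of_nat (card (UNIV :: 'k::{finite,field} set)) = (0 :: 'k)"
proof -
  \<comment> \<open>Translation by 1 permutes the field, and comparing the two sums leaves the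
    number of elements times 1.\<close>
  have "(\<Sum>x\<in>UNIV. x + 1 :: 'k) = (\<Sum>x\<in>UNIV. x)"
    by (rule sum.reindex_bij_betw) (auto intro!: bij_betwI[where g = "\<lambda>x. x - 1"])
  then show ?thesis by (simp add: sum.distrib)
qed

lemma even_card_char2:
  assumes "card (UNIV :: 'k::{finite,field} set) = 2 ^ r"
  shows "(2 :: 'k) = 0"
  using of_nat_card_eq_0[where 'k = 'k] assms by simp

lemma odd_card_two_nonzero:
  assumes "odd (card (UNIV :: 'k::{finite,field} set))"
  shows "(2 :: 'k) \<noteq> 0"
proof
  assume two: "(2 :: 'k) = 0"
  obtain j where "CARD('k) = 2 * j + 1" using assms oddE by blast
  then have "of_nat CARD('k) = (2 * of_nat j + 1 :: 'k)" by simp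
  then show False using of_nat_card_eq_0[where 'k = 'k] two by simp
qed

text \<open>Squaring is additive in characteristic two, hence injective, hence surjective on a
  finite field.\<close>

lemma char2_square:
  fixes x :: "'k::{finite,field}"
  assumes "(2 :: 'k) = 0"
  obtains y where "x = y ^ 2"
proof -
  have "inj (\<lambda>y :: 'k. y ^ 2)"
  proof (rule injI)
    fix y z :: 'k assume "y ^ 2 = z ^ 2"
    then have "(y - z) ^ 2 = 0" using assms by (simp add: power2_diff)
    then show "y = z" by simp
  qed
  then have "surj (\<lambda>y :: 'k. y ^ 2)" by (simp add: finite_UNIV_inj_surj)
  then show ?thesis using that by (metis surjD)
qed

lemma power_card:
  fixes x :: "'k::{finite,field}"
  shows "x ^ CARD('k) = x"
proof (cases "x = 0")
  case True
  then show ?thesis by (simp add: zero_power)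
next
  case False
  let ?S = "UNIV - {0} :: 'k set"
  \<comment> \<open>Multiplication by \<open>x\<close> permutes the nonzero elements.\<close>
  have "(\<Prod>y\<in>?S. x * y) = (\<Prod>y\<in>?S. y)"
    using False by (intro prod.reindex_bij_betw bij_betwI[where g = "\<lambda>y. y / x"]) auto
  moreover have "(\<Prod>y\<in>?S. x * y) = x ^ (CARD('k) - 1) * (\<Prod>y\<in>?S. y)"
    by (simp add: prod.distrib card_Diff_singleton)
  moreover have "(\<Prod>y\<in>?S. y) \<noteq> 0" by simp
  ultimately have "x ^ (CARD('k) - 1) = 1" by simp
  then have "x * x ^ (CARD('k) - 1) = x" by simp
  then show ?thesis by (metis power_Suc Suc_pred' zero_less_card_finite)
qed

lemma char2_power_add:
  assumes "(2 :: 'k::field) = 0"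
  shows "(x + y) ^ (2 ^ i) = x ^ (2 ^ i) + (y :: 'k) ^ (2 ^ i)"
proof (induction i)
  case (Suc i)
  have "(x + y) ^ (2 ^ Suc i) = ((x + y) ^ (2 ^ i)) ^ 2" by (simp add: power_mult[symmetric] mult.commute)
  also have "\<dots> = x ^ (2 ^ Suc i) + y ^ (2 ^ Suc i)"
    unfolding Suc power2_sum using assms by (simp add: power_mult[symmetric] mult.commute)
  finally show ?case .
qed simp

text \<open>
  The trace vanishes on the image of \<open>y \<mapsto> y\<^sup>2 + y\<close>, which has \<open>2 ^ (r - 1)\<close> elements; as a
  polynomial of degree \<open>2 ^ (r - 1)\<close> it has no further zeros.
\<close>

lemma artin_schreier_trace:
  fixes \<alpha> :: "'k::{finite,field}"
  assumes q: "CARD('k) = 2 ^ r" and r: "r \<ge> 1" and no_root: "\<And>y. y ^ 2 + y + \<alpha> \<noteq> 0"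
  shows "(\<Sum>i<r. \<alpha> ^ (2 ^ i)) = 1"
proof -
  have two: "(2 :: 'k) = 0" using q by (rule even_card_char2)
  have dbl: "x + x = 0" for x :: 'k using two by (metis mult_2 mult_zero_left)
  define Tr :: "'k \<Rightarrow> 'k" where "Tr x = (\<Sum>i<r. x ^ (2 ^ i))" for x
  have pw: "x ^ (2 ^ r) = x" for x :: 'k using power_card[of x] q by simp
  have Tr_sq: "(\<Sum>i<r. x ^ (2 ^ Suc i)) = Tr x" for x
  proof -
    obtain s where s: "r = Suc s" using r by (cases r) auto
    have "(\<Sum>i<r. x ^ (2 ^ Suc i)) = (\<Sum>i<s. x ^ (2 ^ Suc i)) + x ^ (2 ^ r)"
      unfolding s by simp
    also have "\<dots> = x ^ (2 ^ 0) + (\<Sum>i<s. x ^ (2 ^ Suc i))" using pw by simp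
    also have "\<dots> = Tr x" unfolding Tr_def s by (rule sum.lessThan_Suc_shift[symmetric])
    finally show ?thesis .
  qed
  have Tr_add: "Tr (x + y) = Tr x + Tr y" for x y
    by (simp add: Tr_def char2_power_add[OF two] sum.distrib)
  have "Tr (x ^ 2) = Tr x" for x
    using Tr_sq[of x] by (simp add: Tr_def power_mult[symmetric])
  then have im: "range (\<lambda>y. y ^ 2 + y) \<subseteq> {x. Tr x = 0}"
    using dbl by (auto simp: Tr_add)
  have "CARD('k) \<le> 2 * card (range (\<lambda>y :: 'k. y ^ 2 + y))"
  proof -
    let ?S = "range (\<lambda>y :: 'k. y ^ 2 + y)"
    have fib: "card {x :: 'k. x ^ 2 + x = a} \<le> 2" if a: "a \<in> ?S" for a
    proof -
      obtain z where z: "a = z ^ 2 + z" using a by auto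
      have "x = z \<or> x = z + 1" if "x ^ 2 + x = a" for x
      proof -
        have "(x - z) * (x - z - 1) = (x ^ 2 + x) - (z ^ 2 + z) + 2 * (z ^ 2 + z - x * z - x)"
          by (simp add: algebra_simps power2_eq_square)
        also have "\<dots> = 0" using that z two by simp
        finally have "x - z = 0 \<or> x - z - 1 = 0" by simp
        then show ?thesis by (auto simp: algebra_simps)
      qed
      then have "{x. x ^ 2 + x = a} \<subseteq> {z, z + 1}" by auto
      then have "card {x. x ^ 2 + x = a} \<le> card {z, z + 1}" by (rule card_mono[rotated]) simp
      also have "\<dots> \<le> 2" by (simp add: card_insert_le_m1)
      finally show ?thesis .
    qed
    have "CARD('k) = card (\<Union>a\<in>?S. {x. x ^ 2 + x = a})"
      by (rule arg_cong[where f = card]) auto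
    also have "\<dots> \<le> (\<Sum>a\<in>?S. card {x :: 'k. x ^ 2 + x = a})"
      by (rule card_UN_le) simp
    also have "\<dots> \<le> (\<Sum>a\<in>?S. 2)" using fib by (rule sum_mono)
    finally show ?thesis by simp
  qed
  moreover have "card {x. Tr x = 0} \<le> 2 ^ (r - 1)"
  proof -
    define p :: "'k poly" where "p = (\<Sum>i<r. monom 1 (2 ^ i))"
    have "degree p \<le> 2 ^ (r - 1)"
      unfolding p_def by (intro degree_sum_le) (auto simp: degree_monom_eq)
    moreover have "coeff p 1 = 1"
    proof -
      have "coeff p 1 = (\<Sum>i<r. if i = 0 then 1 else 0)"
        unfolding p_def coeff_sum by (intro sum.cong) auto
      then show ?thesis using r by simp
    qed
    then have "p \<noteq> 0" by auto
    moreover have "{x. Tr x = 0} = {x. poly p x = 0}"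
      by (simp add: p_def Tr_def poly_sum poly_monom)
    ultimately show ?thesis using card_poly_roots_bound[of p] by simp
  qed
  moreover have "2 * 2 ^ (r - 1) = (2 :: nat) ^ r" using r by (cases r) auto
  ultimately have "card {x. Tr x = 0} \<le> card (range (\<lambda>y :: 'k. y ^ 2 + y))"
    using q by linarith
  then have "range (\<lambda>y. y ^ 2 + y) = {x. Tr x = 0}"
    using im by (intro card_seteq) auto
  moreover have "\<alpha> \<notin> range (\<lambda>y. y ^ 2 + y)"
    using no_root dbl by (metis (no_types, lifting) imageE)
  ultimately have "Tr \<alpha> \<noteq> 0" by blast
  \<comment> \<open>Squaring permutes the summands of the trace cyclically, so the trace is 0 or
    1.\<close>
  moreover have "Tr \<alpha> ^ 2 = Tr \<alpha>"
  proof -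
    have sq: "(\<Sum>i\<in>A. f i) ^ 2 = (\<Sum>i\<in>A. f i ^ 2)" if "finite A" for A :: "nat set" and f :: "nat \<Rightarrow> 'k"
      using that
    proof (induction A)
      case (insert i A)
      then show ?case using char2_power_add[OF two, of "f i" "sum f A" 1] by simp
    qed simp
    have "Tr \<alpha> ^ 2 = (\<Sum>i<r. \<alpha> ^ (2 ^ Suc i))"
      unfolding Tr_def by (subst sq) (simp_all add: power_mult[symmetric] mult.commute)
    then show ?thesis using Tr_sq by simp
  qed
  ultimately have "Tr \<alpha> = 1" by (simp add: power2_eq_square)
  then show ?thesis by (simp add: Tr_def)
qed

section \<open>Changes of coordinates\<close>

text \<open>Indexing by natural numbers lets a basis be supplied as a list through
  \<open>(!) [x, y, z]\<close>.\<close>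

definition indep_cols :: "nat \<Rightarrow> (nat \<Rightarrow> 'k::field vec) \<Rightarrow> bool" where
  "indep_cols N bs \<longleftrightarrow> (\<forall>j\<le>N. bs j \<in> carrier_vec (N + 1)) \<and>
     (\<forall>y. (\<forall>i\<le>N. (\<Sum>j\<le>N. y j * bs j $ i) = 0) \<longrightarrow> (\<forall>j\<le>N. y j = 0))"

lemma indep_cols_inverse:
  fixes bs :: "nat \<Rightarrow> 'k::field vec"
  assumes bs: "indep_cols N bs"
  defines "A \<equiv> mat (N + 1) (N + 1) (\<lambda>(i, j). bs j $ i)"
  obtains C where "C \<in> carrier_mat (N + 1) (N + 1)" "A * C = 1\<^sub>m (N + 1)" "C * A = 1\<^sub>m (N + 1)"
proof -
  have A: "A \<in> carrier_mat (N + 1) (N + 1)" by (simp add: A_def)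
  have "det A \<noteq> 0"
  proof
    assume "det A = 0"
    then obtain v where v: "v \<in> carrier_vec (N + 1)" "v \<noteq> 0\<^sub>v (N + 1)" "A *\<^sub>v v = 0\<^sub>v (N + 1)"
      using det_0_iff_vec_prod_zero_field[OF A] by blast
    have "(\<Sum>j\<le>N. v $ j * bs j $ i) = 0" if "i \<le> N" for i
    proof -
      have "(A *\<^sub>v v) $ i = (\<Sum>j\<in>{0..<N + 1}. bs j $ i * v $ j)"
        using that v(1) by (simp add: A_def scalar_prod_def)
      also have "\<dots> = (\<Sum>j\<le>N. v $ j * bs j $ i)"
        by (intro sum.cong) (auto simp: mult.commute)
      finally show ?thesis using v(3) that by simp
    qed
    then have "\<forall>j\<le>N. v $ j = 0" using bs unfolding indep_cols_def by blast
    then show False using v(1,2) by (metis Suc_eq_plus1 carrier_vecD eq_vecI index_zero_vec less_Suc_eq_le)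
  qed
  then have inv: "inverse (det A) \<cdot>\<^sub>m (det A \<cdot>\<^sub>m 1\<^sub>m (N + 1)) = 1\<^sub>m (N + 1)"
    by (intro eq_matI) auto
  show ?thesis
  proof (rule that[of "inverse (det A) \<cdot>\<^sub>m adj_mat A"])
    show "inverse (det A) \<cdot>\<^sub>m adj_mat A \<in> carrier_mat (N + 1) (N + 1)"
      using adj_mat(1)[OF A] by simp
    show "A * (inverse (det A) \<cdot>\<^sub>m adj_mat A) = 1\<^sub>m (N + 1)"
      using mult_smult_distrib[OF A adj_mat(1)[OF A]] adj_mat(2)[OF A] inv by simp
    show "inverse (det A) \<cdot>\<^sub>m adj_mat A * A = 1\<^sub>m (N + 1)"
      using mult_smult_assoc_mat[OF adj_mat(1)[OF A] A] adj_mat(3)[OF A] inv by simp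
  qed
qed

lemma proj_equivI:
  fixes bs :: "nat \<Rightarrow> 'k::field vec"
  assumes bs: "indep_cols N bs" and F: "in_vars (N + 1) F" and c: "c \<noteq> 0"
    and eq: "peval Const F (\<lambda>i. \<Sum>j\<le>N. Const (bs j $ i) * Var j) = Const c * G"
  shows "proj_equiv N F G"
proof -
  let ?A = "mat (N + 1) (N + 1) (\<lambda>(i, j). bs j $ i)"
  obtain C where "C \<in> carrier_mat (N + 1) (N + 1)" "?A * C = 1\<^sub>m (N + 1)" "C * ?A = 1\<^sub>m (N + 1)"
    by (rule indep_cols_inverse[OF bs])
  then have "invertible_mat ?A"
    unfolding invertible_mat_def inverts_mat_def by (auto intro!: exI[of _ C])
  moreover have "peval Const F (\<lambda>i. \<Sum>j\<le>N. Const (?A $$ (i, j)) * Var j) =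
      peval Const F (\<lambda>i. \<Sum>j\<le>N. Const (bs j $ i) * Var j)"
    using F by (intro peval_cong_vars sum.cong) auto
  ultimately show ?thesis
    unfolding proj_equiv_def using c eq by (intro exI[of _ ?A] exI[of _ c]) auto
qed

text \<open>The inverse matrix over the base field computes the coordinates over the closure too, so
  a rational basis stays a basis.\<close>

lemma indep_cols_spans_ac:
  fixes bs :: "nat \<Rightarrow> 'k::field vec" and x :: "nat \<Rightarrow> 'k alg_closure"
  assumes bs: "indep_cols N bs"
  obtains y where "\<And>i. i \<le> N \<Longrightarrow> x i = (\<Sum>j\<le>N. y j * to_ac (bs j $ i))"
proof -
  let ?A = "mat (N + 1) (N + 1) (\<lambda>(i, j). bs j $ i)"
  obtain C where C: "C \<in> carrier_mat (N + 1) (N + 1)" "?A * C = 1\<^sub>m (N + 1)"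
    by (rule indep_cols_inverse[OF bs])
  have AC: "(\<Sum>j\<le>N. bs j $ i * C $$ (j, k)) = (if i = k then 1 else 0)" if "i \<le> N" "k \<le> N" for i k
  proof -
    have "(?A * C) $$ (i, k) = (\<Sum>j\<in>{0..<N + 1}. bs j $ i * C $$ (j, k))"
      using that C(1) by (simp add: scalar_prod_def)
    also have "\<dots> = (\<Sum>j\<le>N. bs j $ i * C $$ (j, k))" by (intro sum.cong) auto
    finally show ?thesis using C(2) that by simp
  qed
  define y where "y j = (\<Sum>k\<le>N. to_ac (C $$ (j, k)) * x k)" for j
  show ?thesis
  proof (rule that[of y])
    fix i assume i: "i \<le> N"
    have "(\<Sum>j\<le>N. y j * to_ac (bs j $ i)) =
        (\<Sum>j\<le>N. \<Sum>k\<le>N. to_ac (bs j $ i * C $$ (j, k)) * x k)"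
      by (simp add: y_def sum_distrib_left sum_distrib_right mult_ac)
    also have "\<dots> = (\<Sum>k\<le>N. to_ac (\<Sum>j\<le>N. bs j $ i * C $$ (j, k)) * x k)"
      by (subst sum.swap) (simp add: to_ac_sum sum_distrib_right)
    also have "\<dots> = (\<Sum>k\<le>N. if i = k then x k else 0)"
      using AC[OF i] by (intro sum.cong) auto
    also have "\<dots> = x i" using i by simp
    finally show "x i = (\<Sum>j\<le>N. y j * to_ac (bs j $ i))" by simp
  qed
qed

text \<open>Singular points are the zeros of the form in the radical of the polar form. Both
  conditions are kept because in characteristic two a vector of the radical need not be a
  zero.\<close>

lemma nonsingularI:
  fixes F :: "'k::field mpoly"
  assumes F: "in_vars (N + 1) F" "homog 2 F"
    and radical: "\<And>x. peval to_ac F x = 0 \<Longrightarrow> (\<And>w. polar to_ac F x w = 0) \<Longrightarrow> \<forall>i\<le>N. x i = 0"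
  shows "nonsingular N F"
  unfolding nonsingular_def
proof (intro ballI)
  fix P x assume P: "P \<in> proj_zeros to_ac N F" and x: "x \<in> P"
  have vars: "\<forall>m\<in>Poly_Mapping.keys F. Poly_Mapping.keys m \<subseteq> {..N}"
    using F(1) by (simp add: in_vars_def lessThan_Suc_atMost)
  show "\<exists>i\<le>N. peval to_ac (pderivative i F) (\<lambda>j. x $ j) \<noteq> 0"
  proof (rule ccontr)
    assume "\<not> ?thesis"
    then have "polar to_ac F (\<lambda>j. x $ j) w = 0" for w
      using coeff_line_poly_1[OF to_ac_hom.comm_ring_hom_axioms vars, of "\<lambda>j. x $ j" w]
      by (simp add: to_ac_hom.coeff_line_poly_polar[OF F(2), simplified])
    moreover have "peval to_ac F (\<lambda>j. x $ j) = 0" using P x by (auto simp: proj_zeros_def)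
    ultimately have "\<forall>i\<le>N. x $ i = 0" using radical by blast
    moreover have "x \<in> carrier_vec (N + 1)" "x \<noteq> 0\<^sub>v (N + 1)"
      using P x by (auto simp: proj_zeros_def smult_vec_eq_0_iff elim!: proj_spaceE)
    ultimately show False
      by (metis Suc_eq_plus1 carrier_vecD eq_vecI index_zero_vec less_Suc_eq_le)
  qed
qed

text \<open>At a rational point a partial derivative that is nonzero over the closure is already
  nonzero over the base field; the matching unit vector is then a nontangent direction.\<close>

lemma (in line_free_hypersurface) nonsingular_imp_smooth:
  assumes ns: "nonsingular (n + 1) F" and b: "b \<in> V" "b \<noteq> 0\<^sub>v (n + 2)" "val F b = 0"
  shows "\<exists>v\<in>V. T b v \<noteq> 0"
proof -
  have vars': "\<forall>m\<in>Poly_Mapping.keys F. Poly_Mapping.keys m \<subseteq> {..n + 1}"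
    using vars unfolding in_vars_def by (simp add: lessThan_Suc_atMost)
  let ?b = "map_vec to_ac b :: 'k alg_closure vec" and ?c = "\<lambda>j. to_ac (b $ j)"
  have b': "?b \<in> carrier_vec (n + 2)" using b by simp
  have b0: "?b \<noteq> 0\<^sub>v (n + 2)"
  proof
    assume z: "?b = 0\<^sub>v (n + 2)"
    have "b $ i = 0" if "i < n + 2" for i
      using arg_cong[OF z, of "\<lambda>x :: 'k alg_closure vec. x $ i"] that b by simp
    then show False using b by (metis carrier_vecD eq_vecI index_zero_vec)
  qed
  have "peval to_ac F (\<lambda>j. ?b $ j) = peval to_ac F ?c"
    using b by (intro peval_cong_vars[OF vars]) auto
  then have Fb: "peval to_ac F (\<lambda>j. ?b $ j) = 0" using b(3) by (simp add: peval_to_ac)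
  have "{c \<cdot>\<^sub>v ?b |c. c \<noteq> 0} \<in> proj_zeros to_ac (n + 1) F"
    unfolding proj_zeros_def
  proof (intro CollectI conjI ballI)
    show "{c \<cdot>\<^sub>v ?b |c. c \<noteq> 0} \<in> proj_space (n + 1)"
      using b' b0 by (intro proj_spaceI) (simp_all add: numeral_2_eq_2)
    fix x assume "x \<in> {c \<cdot>\<^sub>v ?b |c. c \<noteq> 0}"
    then obtain c where x: "x = c \<cdot>\<^sub>v ?b" by blast
    show "peval to_ac F (\<lambda>i. x $ i) = 0"
      unfolding x to_ac_hom.peval_smult_vec[OF vars homog b'] using Fb by simp
  qed
  moreover have "?b \<in> {c \<cdot>\<^sub>v ?b |c. c \<noteq> 0}"
    by (intro CollectI exI[of _ 1] conjI) simp_all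
  ultimately have "\<exists>i\<le>n + 1. peval to_ac (pderivative i F) (\<lambda>j. ?b $ j) \<noteq> 0"
    by (rule ns[unfolded nonsingular_def, rule_format])
  then obtain i where i: "i \<le> n + 1" "peval to_ac (pderivative i F) (\<lambda>j. ?b $ j) \<noteq> 0"
    by blast
  \<comment> \<open>The partial derivative is read as the linear coefficient of a restriction, which
    is known to commute with extension of scalars.\<close>
  let ?e = "\<lambda>j. if j = i then 1 else 0 :: 'k" and ?f = "\<lambda>j. if j = i then 1 else 0 :: 'k alg_closure"
  have "peval to_ac (pderivative i F) (\<lambda>j. ?b $ j) = coeff (line_poly to_ac F (\<lambda>j. ?b $ j) ?f) 1"
    using i(1) unfolding coeff_line_poly_1[OF to_ac_hom.comm_ring_hom_axioms vars']
    by (simp add: if_distrib[of "\<lambda>x. x * _"] cong: if_cong del: sum.atMost_Suc)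
  also have "line_poly to_ac F (\<lambda>j. ?b $ j) ?f = line_poly to_ac F ?c (\<lambda>j. to_ac (?e j))"
    unfolding line_poly_def using b by (intro peval_cong_vars[OF vars]) auto
  also have "\<dots> = map_poly to_ac (line_poly id F (\<lambda>j. b $ j) ?e)" by (rule line_poly_to_ac)
  finally have "coeff (line_poly id F (\<lambda>j. b $ j) ?e) 1 \<noteq> 0" using i(2) by (auto simp: coeff_map_poly)
  moreover have "coeff (line_poly id F (\<lambda>j. b $ j) ?e) 1 = val (pderivative i F) b"
    using i(1) unfolding coeff_line_poly_1[OF id_hom.comm_ring_hom_axioms vars']
    by (simp add: if_distrib[of "\<lambda>x. x * _"] cong: if_cong del: sum.atMost_Suc)
  moreover have "T b (unit_vec (n + 2) i) = (\<Sum>j\<le>n + 1. if j = i then val (pderivative i F) b else 0)"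
    unfolding T_def using i(1) by (intro sum.cong) auto
  then have "T b (unit_vec (n + 2) i) = val (pderivative i F) b" using i(1) by (simp del: sum.atMost_Suc)
  ultimately show ?thesis by (intro bexI[of _ "unit_vec (n + 2) i"]) auto
qed

section \<open>Quadrics without rational lines\<close>

lemma smult_smult_inverse:
  fixes x :: "'k::field vec"
  assumes "s \<cdot>\<^sub>v x = t \<cdot>\<^sub>v y" "s \<noteq> 0"
  shows "x = (t / s) \<cdot>\<^sub>v y"
proof -
  have "inverse s \<cdot>\<^sub>v (s \<cdot>\<^sub>v x) = inverse s \<cdot>\<^sub>v (t \<cdot>\<^sub>v y)" using assms by simp
  then show ?thesis using assms(2) by (simp add: smult_smult_assoc field_simps)
qed

lemma vec_subspace_not_line:
  fixes W :: "'k::{finite,field} vec set"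
  assumes "vec_subspace m W" "CARD('k) < card W"
  obtains x where "x \<in> W" "\<nexists>c. x = c \<cdot>\<^sub>v b"
proof -
  have "finite (range (\<lambda>c. c \<cdot>\<^sub>v b))" "card (range (\<lambda>c. c \<cdot>\<^sub>v b)) \<le> CARD('k)"
    by (auto intro: card_image_le)
  then have "\<not> W \<subseteq> range (\<lambda>c. c \<cdot>\<^sub>v b)"
    using assms(2) card_mono by (metis leD order_trans)
  then show ?thesis using that by blast
qed

lemma vec_subspace_nonzero:
  fixes W :: "'k::{finite,field} vec set"
  assumes "vec_subspace m W" "1 < card W"
  obtains x where "x \<in> W" "x \<noteq> 0\<^sub>v m"
proof -
  have "\<not> W \<subseteq> {0\<^sub>v m}" using assms(2) card_mono[of "{0\<^sub>v m}" W] by auto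
  then show ?thesis using that by blast
qed

lemma card_kernel_ge:
  fixes T :: "'k::{finite,field} vec \<Rightarrow> 'k"
  assumes W: "vec_subspace m W" and T: "lin_functional W T"
  shows "card W \<le> CARD('k) * card {x\<in>W. T x = 0}"
proof (cases "\<exists>b\<in>W. T b \<noteq> 0")
  case True
  then show ?thesis using card_kernel[OF W T] by auto
next
  case False
  then have "{x\<in>W. T x = 0} = W" by auto
  then show ?thesis by simp
qed

locale line_free_quadric = line_free_hypersurface F q n 2
  for F :: "'k::{finite,field} mpoly" and q n
begin

abbreviation Q :: "'k vec \<Rightarrow> 'k" where "Q x \<equiv> val F x"

definition B :: "'k vec \<Rightarrow> 'k vec \<Rightarrow> 'k" where
  "B x y = polar id F (\<lambda>i. x $ i) (\<lambda>i. y $ i)"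

lemma B_commute: "B x y = B y x"
  unfolding B_def by (rule polar_commute)

lemma polar_cong:
  assumes "\<And>i. i < n + 2 \<Longrightarrow> x i = x' i" "\<And>i. i < n + 2 \<Longrightarrow> y i = y' i"
  shows "polar \<phi> F x y = polar \<phi> F x' y'"
proof -
  have "peval \<phi> F (\<lambda>i. x i + y i) = peval \<phi> F (\<lambda>i. x' i + y' i)"
    "peval \<phi> F x = peval \<phi> F x'" "peval \<phi> F y = peval \<phi> F y'"
    using assms by (auto intro!: peval_cong_vars[OF vars])
  then show ?thesis by (simp add: polar_def)
qed

lemma Q_smult: "x \<in> V \<Longrightarrow> Q (c \<cdot>\<^sub>v x) = c ^ 2 * Q x"
  by (rule id_hom.peval_smult_vec[OF vars homog])

lemma B_add_left:
  assumes "x \<in> V" "x' \<in> V"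
  shows "B (x + x') y = B x y + B x' y"
proof -
  have "B (x + x') y = polar id F (\<lambda>i. x $ i + x' $ i) (\<lambda>i. y $ i)"
    unfolding B_def using assms by (intro polar_cong) auto
  then show ?thesis by (simp add: polar_add_left[OF homog] B_def)
qed

lemma B_smult_left:
  assumes "x \<in> V"
  shows "B (c \<cdot>\<^sub>v x) y = c * B x y"
proof -
  have "B (c \<cdot>\<^sub>v x) y = polar id F (\<lambda>i. c * x $ i) (\<lambda>i. y $ i)"
    unfolding B_def using assms by (intro polar_cong) auto
  then show ?thesis by (simp add: polar_scale_left[OF homog] B_def)
qed

lemma B_add_right: "x \<in> V \<Longrightarrow> x' \<in> V \<Longrightarrow> B y (x + x') = B y x + B y x'"
  using B_add_left B_commute by metis

lemma B_smult_right: "x \<in> V \<Longrightarrow> B y (c \<cdot>\<^sub>v x) = c * B y x"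
  using B_smult_left B_commute by metis

lemma Q_add:
  assumes "x \<in> V" "y \<in> V"
  shows "Q (x + y) = Q x + Q y + B x y"
proof -
  have "Q (x + y) = peval id F (\<lambda>i. x $ i + y $ i)"
    using assms by (intro peval_cong_vars[OF vars]) auto
  then show ?thesis by (simp add: peval_add_vars B_def)
qed

lemma B_self: "B x x = 2 * Q x"
  unfolding B_def by (rule id_hom.polar_self[OF homog])

lemma T_eq_B: "T x y = B x y"
  using lp_coeffs(4)[of x y] id_hom.coeff_line_poly_polar[OF homog, of "\<lambda>i. x $ i" "\<lambda>i. y $ i"]
  by (simp add: B_def lp_def)

lemma lin_functional_B: "W \<subseteq> V \<Longrightarrow> lin_functional W (B x)"
  unfolding lin_functional_def by (meson B_add_right B_smult_right subsetD)

lemma B_zero: "B x (0\<^sub>v (n + 2)) = 0"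
  using B_smult_right[of "0\<^sub>v (n + 2)" x 0] by simp

text \<open>The three hypotheses are exactly the three coefficients of the restriction to the line
  through \<open>x\<close> and \<open>y\<close>.\<close>

lemma no_isotropic_plane:
  assumes "x \<in> V" "x \<noteq> 0\<^sub>v (n + 2)" "y \<in> V" "Q x = 0" "Q y = 0" "B x y = 0"
  shows "\<exists>c. y = c \<cdot>\<^sub>v x"
proof (rule ccontr)
  assume "\<not> ?thesis"
  then have "lp y x \<noteq> 0" using lp_nonzero[OF assms(1,2,4,3)] by blast
  moreover have "coeff (lp y x) i = 0" for i
  proof -
    consider "i = 0" | "i = 1" | "i = 2" | "i > 2" by linarith
    then show ?thesis
      using lp_coeffs[of y x] assms by cases (auto simp: T_eq_B B_commute coeff_eq_0)
  qed
  ultimately show False by (simp add: poly_eq_iff)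
qed

end

section \<open>The complement of a hyperbolic plane\<close>

locale hyperbolic_quadric = line_free_quadric F q n
  for F :: "'k::{finite,field} mpoly" and q n +
  fixes a b :: "'k vec"
  assumes a: "a \<in> V" "Q a = 0" and b: "b \<in> V" "Q b = 0" and ab: "B a b = 1"
begin

lemma a_nonzero: "a \<noteq> 0\<^sub>v (n + 2)"
  using ab B_zero B_commute by fastforce

text \<open>The orthogonal complement of the hyperbolic plane, written as two nested kernels so that
  each cuts the cardinality by a factor \<open>q\<close>.\<close>

definition U :: "'k vec set" where "U = {x \<in> {x \<in> V. B a x = 0}. B b x = 0}"

lemma U_D: "x \<in> U \<Longrightarrow> x \<in> V" "x \<in> U \<Longrightarrow> B a x = 0" "x \<in> U \<Longrightarrow> B b x = 0"
  "x \<in> U \<Longrightarrow> B x a = 0" "x \<in> U \<Longrightarrow> B x b = 0"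
  by (auto simp: U_def B_commute)

lemma vec_subspace_U: "vec_subspace (n + 2) U"
  unfolding U_def by (intro vec_subspace_kernel vec_subspace_carrier lin_functional_B) auto

lemma U_closed: "x \<in> U \<Longrightarrow> y \<in> U \<Longrightarrow> x + y \<in> U" "x \<in> U \<Longrightarrow> c \<cdot>\<^sub>v x \<in> U"
  using vec_subspace_U by (auto simp: vec_subspace_def)

lemma card_U: "card U = q ^ n"
proof -
  let ?W = "{x \<in> V. B a x = 0}"
  have "q * card ?W = q ^ (n + 2)"
    using card_kernel[OF vec_subspace_carrier lin_functional_B[OF subset_refl], of b a] b ab
    by (simp add: card_carrier_vec q)
  moreover have "q * card U = card ?W"
    unfolding U_def q
  proof (rule card_kernel[where b = a and n = "n + 2"])
    show "vec_subspace (n + 2) ?W"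
      by (intro vec_subspace_kernel vec_subspace_carrier lin_functional_B) auto
    show "lin_functional ?W (B b)" by (rule lin_functional_B) auto
    show "a \<in> ?W" using a by (simp add: B_self)
    show "B b a \<noteq> 0" using ab by (simp add: B_commute)
  qed
  ultimately show ?thesis using q_ge_2 by simp
qed

text \<open>An isotropic vector orthogonal to \<open>a\<close> is a multiple of \<open>a\<close>,
  since there are no lines; pairing with \<open>b\<close> shows that the multiple is zero.\<close>

lemma U_anisotropic:
  assumes "x \<in> U" "Q x = 0"
  shows "x = 0\<^sub>v (n + 2)"
proof -
  obtain c where c: "x = c \<cdot>\<^sub>v a"
    using no_isotropic_plane[OF a(1) a_nonzero, of x] U_D assms a by blast
  have "B b x = c" unfolding c using a ab by (simp add: B_smult_right B_commute)
  then have "c = 0" using U_D assms by simp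
  then show ?thesis using c a by auto
qed

lemma Q_combination:
  assumes "u \<in> U"
  shows "Q (s \<cdot>\<^sub>v a + t \<cdot>\<^sub>v b + u) = s * t + Q u"
  using a b ab U_D[OF assms] by (simp add: Q_add Q_smult B_add_left B_add_right B_smult_left B_smult_right)

lemma B_combination:
  assumes "u \<in> U" "u' \<in> U"
  shows "B (s \<cdot>\<^sub>v a + t \<cdot>\<^sub>v b + u) (s' \<cdot>\<^sub>v a + t' \<cdot>\<^sub>v b + u') = s * t' + t * s' + B u u'"
  using a b ab U_D[OF assms(1)] U_D[OF assms(2)] B_commute[of b a]
  by (simp add: B_add_left B_smult_left B_add_right B_smult_right B_self)

text \<open>On orthogonal vectors the form is additive, and its values are squares
  \<open>g ^ 2\<close> and \<open>h ^ 2\<close>. The combination \<open>h c + g d\<close> is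
  therefore isotropic and must vanish.\<close>

lemma U_dependent_char2:
  assumes "(2 :: 'k) = 0" "c \<in> U" "d \<in> U" "d \<noteq> 0\<^sub>v (n + 2)" "B d c = 0"
  shows "\<exists>t. c = t \<cdot>\<^sub>v d"
proof -
  obtain g h where g: "Q c = g ^ 2" and h: "Q d = h ^ 2"
    using char2_square[OF assms(1)] by metis
  have "h \<noteq> 0" using h U_anisotropic[OF assms(3)] assms(4) by auto
  let ?z = "h \<cdot>\<^sub>v c + g \<cdot>\<^sub>v d"
  have zU: "?z \<in> U" by (intro U_closed assms)
  have "Q ?z = 2 * (h ^ 2 * g ^ 2)"
    using assms U_D[OF assms(2)] U_D[OF assms(3)] B_commute[of c d]
    by (simp add: Q_add Q_smult B_smult_left B_smult_right g h)
  then have "?z = 0\<^sub>v (n + 2)" using U_anisotropic[OF zU] assms(1) by simp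
  have "h \<cdot>\<^sub>v c = (- g) \<cdot>\<^sub>v d"
  proof (rule eq_vecI)
    show "(h \<cdot>\<^sub>v c) $ i = ((- g) \<cdot>\<^sub>v d) $ i" if "i < dim_vec ((- g) \<cdot>\<^sub>v d)" for i
      using arg_cong[OF \<open>?z = 0\<^sub>v (n + 2)\<close>, of "\<lambda>x :: 'k vec. x $ i"] that
        U_D(1)[OF assms(2)] U_D(1)[OF assms(3)] by (simp add: eq_neg_iff_add_eq_0)
  qed (use U_D(1)[OF assms(2)] U_D(1)[OF assms(3)] in auto)
  then show ?thesis using smult_smult_inverse[OF _ \<open>h \<noteq> 0\<close>] by blast
qed

text \<open>For \<open>n \<ge> 3\<close> there is room for three mutually orthogonal vectors
  \<open>c\<close>, \<open>d\<close>, \<open>e\<close>. The diagonal form on \<open>c\<close> and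
  \<open>d\<close> represents the negative of the value at \<open>e\<close>, which produces an
  isotropic vector.\<close>

lemma dimension_le_2: "n \<le> 2"
proof (rule ccontr)
  assume "\<not> n \<le> 2"
  then have n3: "n \<ge> 3" by simp
  have "q ^ 0 < q ^ n" using q_ge_2 n3 by (intro power_strict_increasing) auto
  then obtain c where c: "c \<in> U" "c \<noteq> 0\<^sub>v (n + 2)"
    using vec_subspace_nonzero[OF vec_subspace_U] card_U by auto
  let ?U1 = "{x \<in> U. B c x = 0}"
  have UV: "U \<subseteq> V" using U_D by blast
  have sU1: "vec_subspace (n + 2) ?U1"
    by (rule vec_subspace_kernel[OF vec_subspace_U lin_functional_B[OF UV]])
  have pos: "q > 0" using q_ge_2 by simp
  have "q ^ n \<le> q * card ?U1"
    using card_kernel_ge[OF vec_subspace_U lin_functional_B[OF UV]] by (simp add: card_U q[symmetric])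
  moreover have "q ^ n = q * q ^ (n - 1)" using n3 by (cases n) auto
  ultimately have cU1: "q ^ (n - 1) \<le> card ?U1" using pos by simp
  have "q ^ 1 < q ^ (n - 1)" using q_ge_2 n3 by (intro power_strict_increasing) auto
  then have "CARD('k) < card ?U1" using cU1 q by simp
  then obtain d where d: "d \<in> ?U1" "\<nexists>t. d = t \<cdot>\<^sub>v c"
    using vec_subspace_not_line[OF sU1, of c] by blast
  have dU: "d \<in> U" "B c d = 0" using d by auto
  \<comment> \<open>In characteristic two the orthogonal vectors \<open>c\<close> and
    \<open>d\<close> would be proportional, so 2 is invertible from here on.\<close>
  have two: "(2 :: 'k) \<noteq> 0" using U_dependent_char2[OF _ dU(1) c(1,2) dU(2)] d(2) by blast
  let ?U2 = "{x \<in> ?U1. B d x = 0}"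
  have sU2: "vec_subspace (n + 2) ?U2"
    using UV by (intro vec_subspace_kernel[OF sU1] lin_functional_B) auto
  have "card ?U1 \<le> q * card ?U2"
    unfolding q using UV by (intro card_kernel_ge[OF sU1] lin_functional_B) auto
  moreover have "q ^ 2 \<le> q ^ (n - 1)" using q_ge_2 n3 by (intro power_increasing) auto
  ultimately have "q * q \<le> q * card ?U2" using cU1 unfolding power2_eq_square by linarith
  then have "1 < card ?U2" using q_ge_2 by simp
  then obtain e where e: "e \<in> ?U2" "e \<noteq> 0\<^sub>v (n + 2)" using vec_subspace_nonzero[OF sU2] by blast
  have eU: "e \<in> U" "B c e = 0" "B d e = 0" using e by auto
  have "d \<noteq> 0 \<cdot>\<^sub>v c" using d(2) by blast
  then have "d \<noteq> 0\<^sub>v (n + 2)" using U_D(1)[OF c(1)] by auto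
  then have cd: "Q c \<noteq> 0" "Q d \<noteq> 0"
    using U_anisotropic c dU by blast+
  obtain x y where xy: "Q c * x ^ 2 + Q d * y ^ 2 = - Q e"
    by (rule binary_diagonal_universal[OF cd])
  let ?z = "x \<cdot>\<^sub>v c + y \<cdot>\<^sub>v d + e"
  note VV = U_D(1)[OF c(1)] U_D(1)[OF dU(1)] U_D(1)[OF eU(1)]
  have zU: "?z \<in> U" by (intro U_closed c(1) dU(1) eU(1))
  have "Q ?z = x ^ 2 * Q c + y ^ 2 * Q d + Q e"
    using VV dU(2) eU(2,3) by (simp add: Q_add Q_smult B_add_left B_add_right B_smult_left B_smult_right)
  then have "Q ?z = 0" using xy by (simp add: mult.commute)
  then have z: "?z = 0\<^sub>v (n + 2)" using U_anisotropic[OF zU] by blast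
  \<comment> \<open>Anisotropy forces the isotropic vector to be zero. Pairing it with
    \<open>c\<close> and \<open>d\<close> kills their coefficients, so \<open>e\<close> itself would
    be zero.\<close>
  have "B c ?z = x * (2 * Q c)"
    using VV dU eU by (simp add: B_add_right B_smult_right B_self)
  then have "x = 0" using z B_zero two cd by simp
  have "B d ?z = y * (2 * Q d)"
    using VV dU eU B_commute[of d c] by (simp add: B_add_right B_smult_right B_self)
  then have "y = 0" using z B_zero two cd by simp
  have "e = ?z" using VV \<open>x = 0\<close> \<open>y = 0\<close> by (intro eq_vecI) auto
  then show False using z e(2) by simp
qed

text \<open>The condition \<open>B c d = Q d\<close> gives the mixed term and the second square of
  the normal form the same coefficient; only the first square keeps a parameter.\<close>

lemma surface_basis:
  assumes "n = 2"
  obtains c d where "c \<in> U" "d \<in> U" "Q d \<noteq> 0" "B c d = Q d" "\<nexists>t. c = t \<cdot>\<^sub>v d"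
proof -
  have UV: "U \<subseteq> V" using U_D by blast
  have "q ^ 0 < q ^ n" using q_ge_2 assms by (intro power_strict_increasing) auto
  then obtain d where d: "d \<in> U" "d \<noteq> 0\<^sub>v (n + 2)"
    using vec_subspace_nonzero[OF vec_subspace_U] card_U by auto
  have Qd: "Q d \<noteq> 0" using U_anisotropic d by blast
  have "q ^ 1 < q ^ n" using q_ge_2 assms by (intro power_strict_increasing) auto
  then obtain c' where c': "c' \<in> U" "\<nexists>t. c' = t \<cdot>\<^sub>v d"
    using vec_subspace_not_line[OF vec_subspace_U, of d] card_U q by auto
  \<comment> \<open>In characteristic two \<open>d\<close> pairs to zero with itself, and a vector
    outside its span must pair nontrivially; otherwise \<open>d\<close> serves.\<close>
  have "\<exists>e\<in>U. B d e \<noteq> 0"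
  proof (cases "(2 :: 'k) = 0")
    case True
    then show ?thesis using U_dependent_char2[OF True c'(1) d] c' by blast
  next
    case False
    then have "B d d \<noteq> 0" using Qd by (simp add: B_self)
    then show ?thesis using d by blast
  qed
  then obtain e where e: "e \<in> U" "B d e \<noteq> 0" by blast
  define e' where "e' = (Q d / B d e) \<cdot>\<^sub>v e"
  have e': "e' \<in> U" "B d e' = Q d"
    using e U_closed U_D(1)[OF e(1)] by (auto simp: e'_def B_smult_right)
  show ?thesis
  proof (cases "\<exists>t. e' = t \<cdot>\<^sub>v d")
    case False
    then show ?thesis using that[of e' d] e' d Qd by (simp add: B_commute)
  next
    case True
    then obtain t where t: "e' = t \<cdot>\<^sub>v d" by blast
    then have Bdd: "B d d \<noteq> 0" using e'(2) Qd U_D(1)[OF d(1)] by (auto simp: B_smult_right)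
    \<comment> \<open>When \<open>e'\<close> is a multiple of \<open>d\<close>, adding a vector
      orthogonal to \<open>d\<close> preserves the pairing and destroys the dependence, because
      \<open>d\<close> is not orthogonal to itself here.\<close>
    let ?W = "{x \<in> U. B d x = 0}"
    have "q ^ n \<le> q * card ?W"
      using card_kernel_ge[OF vec_subspace_U lin_functional_B[OF UV]] by (simp add: card_U q[symmetric])
    then have "1 < card ?W" using q_ge_2 assms by (simp add: power2_eq_square)
    then obtain f where f: "f \<in> ?W" "f \<noteq> 0\<^sub>v (n + 2)"
      using vec_subspace_nonzero[OF vec_subspace_kernel[OF vec_subspace_U lin_functional_B[OF UV]]]
      by blast
    have fU: "f \<in> U" "B d f = 0" using f by auto
    have VV: "f \<in> V" "d \<in> V" "e' \<in> V" using fU d e' U_D by auto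
    have "\<nexists>s. f + e' = s \<cdot>\<^sub>v d"
    proof
      assume "\<exists>s. f + e' = s \<cdot>\<^sub>v d"
      then obtain s where s: "f + e' = s \<cdot>\<^sub>v d" by blast
      have "f = (s - t) \<cdot>\<^sub>v d"
      proof (rule eq_vecI)
        show "f $ i = ((s - t) \<cdot>\<^sub>v d) $ i" if "i < dim_vec ((s - t) \<cdot>\<^sub>v d)" for i
          using arg_cong[OF s, of "\<lambda>x :: 'k vec. x $ i"] that VV t
          by (simp add: algebra_simps eq_diff_eq)
      qed (use VV in auto)
      then have f': "f = (s - t) \<cdot>\<^sub>v d" .
      then have "(s - t) * B d d = 0" using fU(2) VV by (metis B_smult_right)
      then have "s - t = 0" using Bdd by simp
      then show False using f' f(2) VV by auto
    qed
    moreover have "f + e' \<in> U" using fU e' U_closed by blast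
    moreover have "B (f + e') d = Q d"
      using VV fU e' B_commute[of f d] B_commute[of e' d] by (simp add: B_add_left)
    ultimately show ?thesis using that[of "f + e'" d] d Qd by blast
  qed
qed

end

lemma (in line_free_quadric) hyperbolic_pair:
  assumes x: "x \<in> V" "Q x = 0" and smooth: "\<exists>v\<in>V. T x v \<noteq> 0"
  obtains y where "hyperbolic_quadric F q n x y"
proof -
  obtain v where v: "v \<in> V" "B x v \<noteq> 0" using smooth by (auto simp: T_eq_B)
  define w where "w = inverse (B x v) \<cdot>\<^sub>v v"
  have w: "w \<in> V" "B x w = 1" using v by (simp_all add: w_def B_smult_right)
  \<comment> \<open>Moving \<open>w\<close> along the isotropic vector \<open>x\<close> leaves the
    pairing with \<open>x\<close> unchanged and shifts the value of the form linearly, so it can be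
    made zero.\<close>
  let ?y = "w + (- Q w) \<cdot>\<^sub>v x"
  have "?y \<in> V" using w x by simp
  moreover have "Q ?y = 0" "B x ?y = 1"
    using w x B_commute[of w x]
    by (simp_all add: Q_add Q_smult B_add_right B_smult_right B_self)
  ultimately show ?thesis using x by (intro that[of ?y]) unfold_locales
qed

section \<open>Irreducibility of binary forms\<close>

lemma homog_0_eq_Const:
  assumes "homog 0 F"
  shows "F = Const (Poly_Mapping.lookup F 0)"
proof (rule poly_mapping_eqI)
  fix m
  show "Poly_Mapping.lookup F m = Poly_Mapping.lookup (Const (Poly_Mapping.lookup F 0)) m"
    using assms unfolding homog_def Const_def
    by (cases "m = 0") (auto simp: lookup_single when_def in_keys_iff)
qed

text \<open>Multiplies every variable by an auxiliary variable, so that powers of it record the degree.\<close>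

definition graded :: "'a::comm_ring_1 mpoly \<Rightarrow> 'a mpoly poly" where
  "graded F = peval (\<lambda>c. [:Const c:]) F (\<lambda>i. monom (Var i) 1)"

lemma mon_val_Var: "mon_val m Var = Poly_Mapping.single m (1 :: 'a::comm_ring_1)"
proof (induction "mon_deg m" arbitrary: m)
  case 0
  then have "m = 0" using mon_deg_eq_0_iff[of m] by simp
  then show ?case by simp
next
  case (Suc k)
  obtain i m' where m: "m = Poly_Mapping.single i 1 + m'" "mon_deg m' = k"
    using mon_deg_SucE[of m k] Suc(2) by metis
  then have "mon_val m Var = Var i * Poly_Mapping.single m' (1 :: 'a)"
    using Suc(1)[of m'] by (simp add: mon_val_add)
  then show ?case by (simp add: Var_def mult_single m)
qed

lemma graded_eq: "graded F = (\<Sum>m\<in>Poly_Mapping.keys F.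
    monom (Poly_Mapping.single m (Poly_Mapping.lookup F m)) (mon_deg m))"
proof -
  have "mon_val m (\<lambda>i. monom (Var i) 1) = monom (mon_val m Var :: 'a mpoly) (mon_deg m)" for m
  proof -
    have "(\<Prod>i\<in>S. monom (Var i :: 'a mpoly) 1 ^ e i) = monom (\<Prod>i\<in>S. Var i ^ e i) (\<Sum>i\<in>S. e i)"
      if "finite S" for S and e :: "nat \<Rightarrow> nat"
      using that by (induction S) (simp_all add: monom_power mult_monom one_pCons monom_0)
    then show ?thesis by (simp add: mon_val_def mon_deg_def)
  qed
  then have "[:Const c:] * mon_val m (\<lambda>i. monom (Var i) 1) =
      monom (Poly_Mapping.single m c :: 'a mpoly) (mon_deg m)" for m c
    by (simp add: mon_val_Var smult_monom Const_def mult_single)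
  then show ?thesis by (simp add: graded_def peval_eq del: mult_pCons_left)
qed

lemma graded_mult: "graded (F * G) = graded F * graded G"
proof -
  interpret C: comm_ring_hom "\<lambda>c :: 'a. [:Const c:]"
    by (rule Const_hom.comm_ring_hom_const_poly)
  show ?thesis by (simp add: graded_def)
qed

text \<open>Coefficient \<open>k\<close> is the homogeneous component of degree
  \<open>k\<close>.\<close>

lemma coeff_graded:
  "Poly_Mapping.lookup (coeff (graded F) k) m = (if mon_deg m = k then Poly_Mapping.lookup F m else 0)"
proof -
  have "Poly_Mapping.lookup (coeff (graded F) k) m = (\<Sum>x\<in>Poly_Mapping.keys F.
      if x = m then (if mon_deg m = k then Poly_Mapping.lookup F m else 0) else 0)"
    unfolding graded_eq coeff_sum lookup_sum
    by (intro sum.cong) (auto simp: lookup_single)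
  then show ?thesis by (simp add: in_keys_iff)
qed

lemma homog_iff_graded: "homog k F \<longleftrightarrow> (\<forall>j. j \<noteq> k \<longrightarrow> coeff (graded F) j = 0)"
proof
  assume "homog k F"
  then show "\<forall>j. j \<noteq> k \<longrightarrow> coeff (graded F) j = 0"
    by (intro allI impI poly_mapping_eqI) (auto simp: coeff_graded homog_def in_keys_iff)
next
  assume 0: "\<forall>j. j \<noteq> k \<longrightarrow> coeff (graded F) j = 0"
  show "homog k F"
    unfolding homog_def
  proof (intro ballI, rule ccontr)
    fix m assume "m \<in> Poly_Mapping.keys F" "mon_deg m \<noteq> k"
    then show False using 0 coeff_graded[of F "mon_deg m" m] by (auto simp: in_keys_iff)
  qed
qed

text \<open>The order at 0 never exceeds the degree. Both are additive and both total
  \<open>k\<close>, so they agree for each factor, which is then a single term.\<close>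

lemma monom_factor:
  fixes p p' :: "'a::idom poly"
  assumes eq: "p * p' = monom c k" and c: "c \<noteq> 0"
  obtains i j where "i + j = k" "\<And>l. l \<noteq> i \<Longrightarrow> coeff p l = 0" "\<And>l. l \<noteq> j \<Longrightarrow> coeff p' l = 0"
proof -
  have nz: "p \<noteq> 0" "p' \<noteq> 0" "monom c k \<noteq> 0" using eq c by auto
  have low: "coeff r l = 0" if "l < order 0 r" for r :: "'a poly" and l
  proof -
    obtain s where "r = [:- 0, 1:] ^ order 0 r * s" using order_1[of 0 r] by (auto elim: dvdE)
    then have "r = monom 1 (order 0 r) * s" by (simp add: monom_altdef)
    then show ?thesis using that by (metis coeff_monom_mult not_less)
  qed
  have ord_le: "order 0 r \<le> degree r" if "r \<noteq> 0" for r :: "'a poly"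
    using order_degree[OF that] .
  have "degree p + degree p' = k"
    using degree_mult_eq[OF nz(1,2)] eq c by (simp add: degree_monom_eq)
  moreover have "order 0 p + order 0 p' = k"
  proof -
    have "order 0 (monom c k) = k" using c by simp
    then show ?thesis using order_mult[of p p' 0] eq nz by simp
  qed
  ultimately have o: "order 0 p = degree p" "order 0 p' = degree p'"
    using ord_le[OF nz(1)] ord_le[OF nz(2)] by linarith+
  show ?thesis
  proof (rule that[OF \<open>degree p + degree p' = k\<close>])
    show "coeff p l = 0" if "l \<noteq> degree p" for l
      using that low[of l p] coeff_eq_0[of p l] o by linarith
    show "coeff p' l = 0" if "l \<noteq> degree p'" for l
      using that low[of l p'] coeff_eq_0[of p' l] o by linarith
  qed
qed

text \<open>The graded polynomial of a form is a single term, and so are its factors by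
  \<open>monom_factor\<close>.\<close>

lemma homog_mult_factor:
  fixes F G :: "'a::idom mpoly"
  assumes "homog k (F * G)" "F * G \<noteq> 0"
  obtains i j where "i + j = k" "homog i F" "homog j G"
proof -
  have "graded F * graded G = monom (coeff (graded (F * G)) k) k"
    using assms(1) unfolding graded_mult[symmetric] homog_iff_graded by (intro poly_eqI) simp
  moreover have "coeff (graded (F * G)) k \<noteq> 0"
  proof
    assume 0: "coeff (graded (F * G)) k = 0"
    have "F * G = 0"
    proof (rule poly_mapping_eqI)
      fix m show "Poly_Mapping.lookup (F * G) m = Poly_Mapping.lookup 0 m"
        using 0 coeff_graded[of "F * G" k m] assms(1) by (auto simp: homog_def in_keys_iff split: if_splits)
    qed
    then show False using assms(2) by simp
  qed
  ultimately obtain i j where "i + j = k" "\<And>l. l \<noteq> i \<Longrightarrow> coeff (graded F) l = 0"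
    "\<And>l. l \<noteq> j \<Longrightarrow> coeff (graded G) l = 0"
    by (rule monom_factor) blast
  then show ?thesis using that homog_iff_graded by blast
qed

lemma homog_add: "homog k F \<Longrightarrow> homog k G \<Longrightarrow> homog k (F + G)"
  using Poly_Mapping.keys_add[of F G] unfolding homog_def by blast

lemma homog_mult:
  assumes "homog i F" "homog j G"
  shows "homog (i + j) (F * G)"
  unfolding homog_def
proof
  fix m assume "m \<in> Poly_Mapping.keys (F * G)"
  then obtain a b where "m = a + b" "a \<in> Poly_Mapping.keys F" "b \<in> Poly_Mapping.keys G"
    using keys_mult[of F G] by blast
  then show "mon_deg m = i + j" using assms by (simp add: homog_def mon_deg_add)
qed

lemma homog_Const: "homog 0 (Const c)"
  by (simp add: homog_def Const_def mon_deg_def)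

lemma homog_Var: "homog 1 (Var i)"
  by (simp add: homog_def Var_def)

lemma homog_binary_form: "homog 2 (binary_form \<alpha>)"
proof -
  have V: "homog 2 (Var i * Var j :: 'a mpoly)" for i j
    using homog_mult[OF homog_Var[of i] homog_Var[of j]] by (simp add: numeral_2_eq_2)
  have "homog 2 (Const \<alpha> * (Var 0 * Var 0))"
    using homog_mult[OF homog_Const V, of \<alpha> 0 0] by (simp only: add_0)
  then show ?thesis
    unfolding binary_form_def power2_eq_square using V by (intro homog_add)
qed

text \<open>Factors of the form are themselves forms. Two linear factors, possibly in further
  variables, would restrict on the line (1, t, 0, ...) to a factorization of t^2 + t + \<alpha>, and
  so give a root; a factor of degree 0 is a unit.\<close>

lemma irreducible_binary_form:
  fixes \<alpha> :: "'k::field"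
  assumes no_root: "\<And>y. y ^ 2 + y + \<alpha> \<noteq> 0"
  shows "Factorial_Ring.irreducible (binary_form \<alpha>)"
proof -
  have lp: "line_poly id (binary_form \<alpha>) u v = [:\<alpha>, 1, 1:]" 
    if "u = (\<lambda>i. if i = 0 then 1 else 0)" "v = (\<lambda>i. if i = 1 then 1 else 0)" for u v
  proof -
    interpret C: comm_ring_hom "\<lambda>c :: 'k. [:id c:]" by (rule id_hom.comm_ring_hom_const_poly)
    show ?thesis
      unfolding line_poly_def binary_form_def power2_eq_square
        C.peval_add C.peval_mult C.peval_Const C.peval_Var that by simp
  qed
  define u v :: "nat \<Rightarrow> 'k" where "u = (\<lambda>i. if i = 0 then 1 else 0)" "v = (\<lambda>i. if i = 1 then 1 else 0)"
  have mult: "line_poly id (F * G) u v = line_poly id F u v * line_poly id G u v" for F G :: "'k mpoly"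
  proof -
    interpret C: comm_ring_hom "\<lambda>c :: 'k. [:id c:]" by (rule id_hom.comm_ring_hom_const_poly)
    show ?thesis unfolding line_poly_def by (rule C.peval_mult)
  qed
  have bf0: "binary_form \<alpha> \<noteq> 0"
  proof
    assume "binary_form \<alpha> = 0"
    then have "line_poly id (0 :: 'k mpoly) u v = [:\<alpha>, 1, 1:]" using lp u_v_def by metis
    then show False by (simp add: line_poly_def peval_def)
  qed
  have unit: "F dvd 1" if "homog 0 F" "F \<noteq> 0" for F :: "'k mpoly"
  proof -
    define c where "c = Poly_Mapping.lookup F 0"
    have F: "F = Const c" using homog_0_eq_Const[OF that(1)] by (simp add: c_def)
    then have "c \<noteq> 0" using that(2) by (auto simp: Const_def)
    then have "Const c * Const (inverse c) = 1" by (simp add: Const_def mult_single)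
    then show ?thesis unfolding F by (metis dvdI)
  qed
  show ?thesis
  proof (rule Factorial_Ring.irreducibleI)
    show "binary_form \<alpha> \<noteq> 0" by (rule bf0)
    show "\<not> binary_form \<alpha> dvd 1"
    proof
      assume "binary_form \<alpha> dvd 1"
      then obtain G where "1 = binary_form \<alpha> * G" by (rule dvdE)
      then have "line_poly id (1 :: 'k mpoly) u v = [:\<alpha>, 1, 1:] * line_poly id G u v"
        using mult lp u_v_def by metis
      moreover have "line_poly id (1 :: 'k mpoly) u v = 1" by (simp add: line_poly_def peval_def)
      ultimately have "[:\<alpha>, 1, 1:] dvd 1" by (metis dvdI)
      from dvd_imp_degree_le[OF this] show False by simp
    qed
    fix F G :: "'k mpoly" assume FG: "binary_form \<alpha> = F * G"
    obtain i j where ij: "i + j = 2" "homog i F" "homog j G"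
      using homog_mult_factor[of 2 F G] homog_binary_form[of \<alpha>] bf0 FG by metis
    consider "i = 0" | "j = 0" | "i = 1" "j = 1" using ij(1) by linarith
    then show "F dvd 1 \<or> G dvd 1"
    proof cases
      case 1
      then show ?thesis using unit[of F] ij bf0 FG by auto
    next
      case 2
      then show ?thesis using unit[of G] ij bf0 FG by auto
    next
      case 3
      let ?p = "line_poly id F u v" and ?p' = "line_poly id G u v"
      have eq: "?p * ?p' = [:\<alpha>, 1, 1:]" using mult[of F G] lp[of u v] u_v_def FG by simp
      have "degree ?p \<le> 1" "degree ?p' \<le> 1" using degree_line_poly ij 3 by blast+
      moreover have "degree ?p + degree ?p' = 2"
      proof -
        have "?p \<noteq> 0" "?p' \<noteq> 0" using eq by auto
        then show ?thesis using degree_mult_eq[of ?p ?p'] eq by simp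
      qed
      ultimately have "degree ?p = 1" by linarith
      then obtain a b where p: "?p = [:a, b:]" "b \<noteq> 0" by (metis degree1_coeffs)
      then have "poly ?p (- a / b) = 0" by simp
      then have "poly [:\<alpha>, 1, 1:] (- a / b) = 0" using eq by (metis mult_zero_left poly_mult)
      then have "(- a / b) ^ 2 + (- a / b) + \<alpha> = 0" by (simp add: algebra_simps power2_eq_square)
      then show ?thesis using no_root by blast
    qed
  qed
qed

section \<open>Normal forms of the extremal quadrics\<close>

lemma polar_sum_left:
  assumes F: "homog 2 F" and "finite S"
  shows "polar \<phi> F (\<lambda>i. \<Sum>k\<in>S. y k * c k i) w = (\<Sum>k\<in>S. y k * polar \<phi> F (c k) w)"
  using assms(2)
proof (induction S)
  case empty
  show ?case using polar_scale_left[OF F, of \<phi> 0 "\<lambda>_. 0" w] by simp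
next
  case (insert k S)
  then show ?case by (simp add: polar_add_left[OF F] polar_scale_left[OF F])
qed

lemma quadratic_root:
  fixes \<alpha> s :: "'k::field"
  assumes two: "(2 :: 'k) \<noteq> 0" and s: "s ^ 2 = 1 - 4 * \<alpha>"
  shows "((s - 1) / 2) ^ 2 + (s - 1) / 2 + \<alpha> = 0"
proof -
  define y where "y = (s - 1) / 2"
  have "2 * 2 * (y ^ 2 + y + \<alpha>) = (2 * y) ^ 2 + 2 * (2 * y) + 4 * \<alpha>"
    by (simp add: algebra_simps power2_eq_square)
  also have "2 * y = s - 1" using two by (simp add: y_def)
  also have "(s - 1) ^ 2 + 2 * (s - 1) + 4 * \<alpha> = s ^ 2 - (1 - 4 * \<alpha>)"
    by (simp add: algebra_simps power2_eq_square)
  finally have "2 * 2 * (y ^ 2 + y + \<alpha>) = 0" using s by simp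
  then have "y ^ 2 + y + \<alpha> = 0" using two unfolding mult_eq_0_iff by blast
  then show ?thesis by (simp add: y_def)
qed

context line_free_quadric
begin

text \<open>In coordinates of a rational basis the radical condition becomes a linear system with
  the Gram matrix over the base field.\<close>

lemma nonsingular_basis:
  assumes bs: "indep_cols (n + 1) bs"
    and radical: "\<And>y. peval to_ac F (\<lambda>i. \<Sum>k\<le>n + 1. y k * to_ac (bs k $ i)) = 0 \<Longrightarrow>
      (\<And>j. (\<Sum>k\<le>n + 1. y k * to_ac (B (bs k) (bs j))) = 0) \<Longrightarrow> \<forall>k\<le>n + 1. y k = 0"
  shows "nonsingular (n + 1) F"
proof (rule nonsingularI)
  show "in_vars (n + 1 + 1) F" using vars by (simp add: numeral_2_eq_2)
  show "homog 2 F" by (rule homog)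
  fix x assume x: "peval to_ac F x = 0" "\<And>w. polar to_ac F x w = 0"
  obtain y where y: "\<And>i. i \<le> n + 1 \<Longrightarrow> x i = (\<Sum>k\<le>n + 1. y k * to_ac (bs k $ i))"
    by (rule indep_cols_spans_ac[OF bs, of x]) blast
  let ?x = "\<lambda>i. \<Sum>k\<le>n + 1. y k * to_ac (bs k $ i)"
  have "peval to_ac F ?x = peval to_ac F x"
    using y by (intro peval_cong_vars[OF vars]) (simp del: sum.atMost_Suc)
  then have "peval to_ac F ?x = 0" using x(1) by simp
  moreover have "(\<Sum>k\<le>n + 1. y k * to_ac (B (bs k) (bs j))) = 0" for j
  proof -
    have "polar to_ac F ?x (\<lambda>i. to_ac (bs j $ i)) = polar to_ac F x (\<lambda>i. to_ac (bs j $ i))"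
      using y by (intro polar_cong) (simp_all del: sum.atMost_Suc)
    then show ?thesis
      using x(2) unfolding polar_sum_left[OF homog finite_atMost] B_def to_ac_hom.hom_polar
      by (simp del: sum.atMost_Suc)
  qed
  ultimately have "\<forall>k\<le>n + 1. y k = 0" by (rule radical)
  then show "\<forall>i\<le>n + 1. x i = 0" using y by (simp del: sum.atMost_Suc)
qed

lemma indep_cols3:
  assumes n: "n = 1" and V: "x \<in> V" "y \<in> V" "z \<in> V"
    and indep: "\<And>s t w. s \<cdot>\<^sub>v x + t \<cdot>\<^sub>v y + w \<cdot>\<^sub>v z = 0\<^sub>v (n + 2) \<Longrightarrow> s = 0 \<and> t = 0 \<and> w = 0"
  shows "indep_cols (n + 1) ((!) [x, y, z])"
  unfolding indep_cols_def
proof (intro conjI allI impI)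
  have le: "j = 0 \<or> j = 1 \<or> j = 2" if "j \<le> n + 1" for j using that n by linarith
  show "[x, y, z] ! j \<in> carrier_vec (n + 1 + 1)" if "j \<le> n + 1" for j
    using le[OF that] V by auto
  fix c j assume c: "\<forall>i\<le>n + 1. (\<Sum>j\<le>n + 1. c j * [x, y, z] ! j $ i) = 0" and j: "j \<le> n + 1"
  have "c 0 \<cdot>\<^sub>v x + c 1 \<cdot>\<^sub>v y + c 2 \<cdot>\<^sub>v z = 0\<^sub>v (n + 2)"
  proof (rule eq_vecI)
    fix i assume "i < dim_vec (0\<^sub>v (n + 2) :: 'k vec)"
    then show "(c 0 \<cdot>\<^sub>v x + c 1 \<cdot>\<^sub>v y + c 2 \<cdot>\<^sub>v z) $ i = 0\<^sub>v (n + 2) $ i"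
      using c[rule_format, of i] V n by (simp add: numeral_2_eq_2 add.assoc)
  qed (use V in auto)
  then show "c j = 0" using indep le[OF j] by auto
qed

lemma indep_cols4:
  assumes n: "n = 2" and V: "x \<in> V" "y \<in> V" "z \<in> V" "e \<in> V"
    and indep: "\<And>s t w u. s \<cdot>\<^sub>v x + t \<cdot>\<^sub>v y + w \<cdot>\<^sub>v z + u \<cdot>\<^sub>v e = 0\<^sub>v (n + 2) \<Longrightarrow>
      s = 0 \<and> t = 0 \<and> w = 0 \<and> u = 0"
  shows "indep_cols (n + 1) ((!) [x, y, z, e])"
  unfolding indep_cols_def
proof (intro conjI allI impI)
  have le: "j = 0 \<or> j = 1 \<or> j = 2 \<or> j = 3" if "j \<le> n + 1" for j using that n by linarith
  show "[x, y, z, e] ! j \<in> carrier_vec (n + 1 + 1)" if "j \<le> n + 1" for j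
    using le[OF that] V by auto
  fix c j assume c: "\<forall>i\<le>n + 1. (\<Sum>j\<le>n + 1. c j * [x, y, z, e] ! j $ i) = 0" and j: "j \<le> n + 1"
  have "c 0 \<cdot>\<^sub>v x + c 1 \<cdot>\<^sub>v y + c 2 \<cdot>\<^sub>v z + c 3 \<cdot>\<^sub>v e = 0\<^sub>v (n + 2)"
  proof (rule eq_vecI)
    fix i assume "i < dim_vec (0\<^sub>v (n + 2) :: 'k vec)"
    then show "(c 0 \<cdot>\<^sub>v x + c 1 \<cdot>\<^sub>v y + c 2 \<cdot>\<^sub>v z + c 3 \<cdot>\<^sub>v e) $ i = 0\<^sub>v (n + 2) $ i"
      using c[rule_format, of i] V n by (simp add: numeral_2_eq_2 numeral_3_eq_3 add.assoc)
  qed (use V in auto)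
  then show "c j = 0" using indep le[OF j] by auto
qed

lemma substitution3:
  assumes n: "n = 1"
  shows "peval Const F (\<lambda>i. \<Sum>j\<le>n + 1. Const ([x, y, z] ! j $ i) * Var j) =
    Const (Q x) * Var 0 ^ 2 + Const (Q y) * Var 1 ^ 2 + Const (Q z) * Var 2 ^ 2 +
    Const (B x y) * Var 0 * Var 1 + Const (B x z) * Var 0 * Var 2 + Const (B y z) * Var 1 * Var 2"
proof -
  have "(\<lambda>i. \<Sum>j\<le>n + 1. Const ([x, y, z] ! j $ i) * Var j) =
      (\<lambda>i. Var 0 * Const (x $ i) + Var 1 * Const (y $ i) + Var 2 * Const (z $ i))"
    using n by (simp add: numeral_2_eq_2 mult.commute)
  then show ?thesis
    unfolding B_def by (simp only: Const_hom.peval_linear_combination3[OF homog])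
qed

lemma substitution4:
  assumes n: "n = 2"
  shows "peval Const F (\<lambda>i. \<Sum>j\<le>n + 1. Const ([x, y, z, e] ! j $ i) * Var j) =
    Const (Q x) * Var 0 ^ 2 + Const (Q y) * Var 1 ^ 2 + Const (Q z) * Var 2 ^ 2 + Const (Q e) * Var 3 ^ 2 +
    Const (B x y) * Var 0 * Var 1 + Const (B x z) * Var 0 * Var 2 + Const (B y z) * Var 1 * Var 2 +
    Const (B x e) * Var 0 * Var 3 + Const (B y e) * Var 1 * Var 3 + Const (B z e) * Var 2 * Var 3"
proof -
  have "(\<lambda>i. \<Sum>j\<le>n + 1. Const ([x, y, z, e] ! j $ i) * Var j) =
      (\<lambda>i. Var 0 * Const (x $ i) + Var 1 * Const (y $ i) + Var 2 * Const (z $ i) + Var 3 * Const (e $ i))"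
    using n by (simp add: numeral_2_eq_2 numeral_3_eq_3 mult.commute)
  then show ?thesis
    unfolding B_def by (simp only: Const_hom.peval_linear_combination4[OF homog])
qed

end

section \<open>Conics and surfaces in coordinates adapted to the hyperbolic pair\<close>

context hyperbolic_quadric
begin

text \<open>Pairing with \<open>b\<close> reads off \<open>s\<close> and pairing with
  \<open>a\<close> reads off \<open>t\<close>.\<close>

lemma combination_eq_0:
  assumes u: "u \<in> U" and z: "s \<cdot>\<^sub>v a + t \<cdot>\<^sub>v b + u = 0\<^sub>v (n + 2)"
  shows "s = 0" "t = 0" "u = 0\<^sub>v (n + 2)"
proof -
  have U0: "0\<^sub>v (n + 2) \<in> U" using vec_subspace_U by (simp add: vec_subspace_def)
  have "B (0 \<cdot>\<^sub>v a + 1 \<cdot>\<^sub>v b + 0\<^sub>v (n + 2)) (s \<cdot>\<^sub>v a + t \<cdot>\<^sub>v b + u) = s"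
    "B (1 \<cdot>\<^sub>v a + 0 \<cdot>\<^sub>v b + 0\<^sub>v (n + 2)) (s \<cdot>\<^sub>v a + t \<cdot>\<^sub>v b + u) = t"
    unfolding B_combination[OF U0 u] by (simp_all add: B_zero B_commute[of "0\<^sub>v (n + 2)"] del: add_2_eq_Suc')
  then show st: "s = 0" "t = 0" using z B_zero by simp_all
  have "s \<cdot>\<^sub>v a + t \<cdot>\<^sub>v b + u = u" using a b U_D(1)[OF u] unfolding st by (intro eq_vecI) auto
  then show "u = 0\<^sub>v (n + 2)" using z by simp
qed

lemma conic_nonsingular:
  assumes n: "n = 1"
  shows "nonsingular (n + 1) F"
proof -
  have "q ^ 0 < q ^ n" using q_ge_2 n by (intro power_strict_increasing) auto
  then obtain c where c: "c \<in> U" "c \<noteq> 0\<^sub>v (n + 2)"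
    using vec_subspace_nonzero[OF vec_subspace_U] card_U by auto
  have Qc: "Q c \<noteq> 0" using U_anisotropic c by blast
  have cV: "c \<in> V" using U_D c by blast
  have indep: "indep_cols (n + 1) ((!) [a, b, c])"
  proof (rule indep_cols3[OF n a(1) b(1) cV])
    fix s t w assume z: "s \<cdot>\<^sub>v a + t \<cdot>\<^sub>v b + w \<cdot>\<^sub>v c = 0\<^sub>v (n + 2)"
    from combination_eq_0[OF U_closed(2)[OF c(1)] z]
    show "s = 0 \<and> t = 0 \<and> w = 0" using c(2) smult_vec_eq_0_iff[OF cV] by auto
  qed
  show ?thesis
  proof (rule nonsingular_basis[OF indep])
    fix y :: "nat \<Rightarrow> 'k alg_closure"
    assume F0: "peval to_ac F (\<lambda>i. \<Sum>k\<le>n + 1. y k * to_ac ([a, b, c] ! k $ i)) = 0"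
      and polar0: "\<And>j. (\<Sum>k\<le>n + 1. y k * to_ac (B ([a, b, c] ! k) ([a, b, c] ! j))) = 0"
    have y1: "y 1 = 0" and y0: "y 0 = 0"
      using polar0[of 0] polar0[of 1] n ab a b U_D[OF c(1)] B_commute[of b a]
      by (simp_all add: numeral_2_eq_2 B_self)
    \<comment> \<open>The pairing with \<open>c\<close> would give only \<open>2 * Q c\<close> times
      \<open>y 2\<close>, which is void in characteristic two; the vanishing of the form itself is
      used instead.\<close>
    have "peval to_ac F (\<lambda>i. y 2 * to_ac (c $ i)) = 0"
      using F0 y0 y1 n by (simp add: numeral_2_eq_2)
    then have "y 2 = 0" using Qc by (simp add: to_ac_hom.peval_scale[OF homog] peval_to_ac)
    then show "\<forall>k\<le>n + 1. y k = 0"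
      using y0 y1 n by (auto simp: numeral_2_eq_2 le_Suc_eq)
  qed
qed

lemma conic_normal_form:
  assumes n: "n = 1" and two: "(2 :: 'k) \<noteq> 0"
  shows "proj_equiv (n + 1) F (Var 0 ^ 2 + Var 1 ^ 2 + Var 2 ^ 2)"
proof -
  have "q ^ 0 < q ^ n" using q_ge_2 n by (intro power_strict_increasing) auto
  then obtain c where c: "c \<in> U" "c \<noteq> 0\<^sub>v (n + 2)"
    using vec_subspace_nonzero[OF vec_subspace_U] card_U by auto
  define \<gamma> where "\<gamma> = Q c"
  have \<gamma>: "\<gamma> \<noteq> 0" using U_anisotropic c unfolding \<gamma>_def by blast
  have cV: "c \<in> V" using U_D c by blast
  obtain u v :: 'k where "1 * u ^ 2 + 1 * v ^ 2 = - 1"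
    using binary_diagonal_universal[of 1 1 "- 1"] by auto
  then have uv: "u * u + v * v = - 1" by (simp add: power2_eq_square)
  define w where "w s t r = s \<cdot>\<^sub>v a + t \<cdot>\<^sub>v b + r \<cdot>\<^sub>v c" for s t r
  have wV: "w s t r \<in> V" for s t r using a b cV by (simp add: w_def)
  have Qw: "Q (w s t r) = s * t + r * r * \<gamma>" for s t r
    unfolding w_def using Q_combination[OF U_closed(2)[OF c(1)]] cV
    by (simp add: Q_smult \<gamma>_def power2_eq_square)
  have Bw: "B (w s t r) (w s' t' r') = s * t' + t * s' + 2 * r * r' * \<gamma>" for s t r s' t' r'
    unfolding w_def using B_combination[OF U_closed(2)[OF c(1)] U_closed(2)[OF c(1)]] cV
    by (simp add: B_smult_left B_smult_right B_self \<gamma>_def)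
  \<comment> \<open>The hyperbolic plane has the orthogonal vectors \<open>a - \<gamma> b\<close>
    and \<open>a + \<gamma> b\<close> with values \<open>- \<gamma>\<close> and
    \<open>\<gamma>\<close>. The latter and \<open>c\<close>, both of value \<open>\<gamma>\<close>,
    are mixed by \<open>u\<close> and \<open>v\<close> with u^2 + v^2 = -1, which turns both values
    into \<open>- \<gamma>\<close>. The common factor is absorbed by the scalar of the
    equivalence.\<close>
  define x y z where "x = w 1 (- \<gamma>) 0" "y = w v (v * \<gamma>) u" "z = w u (u * \<gamma>) (- v)"
  have V: "x \<in> V" "y \<in> V" "z \<in> V" by (simp_all only: x_y_z_def wV)
  have "v * (v * \<gamma>) + u * u * \<gamma> = (u * u + v * v) * \<gamma>" by (simp add: algebra_simps)
  then have Qy: "v * (v * \<gamma>) + u * u * \<gamma> = - \<gamma>" by (simp add: uv)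
  have "u * (u * \<gamma>) + v * v * \<gamma> = (u * u + v * v) * \<gamma>" by (simp add: algebra_simps)
  then have Qz: "u * (u * \<gamma>) + v * v * \<gamma> = - \<gamma>" by (simp add: uv)
  have QQ: "Q x = - \<gamma>" "Q y = - \<gamma>" "Q z = - \<gamma>"
    using Qy Qz by (simp_all add: x_y_z_def Qw)
  have BB: "B x y = 0" "B x z = 0" "B y z = 0"
    by (simp_all add: x_y_z_def Bw algebra_simps)
  have BC: "B y x = 0" "B z x = 0" "B z y = 0" using BB B_commute by metis+
  have indep: "indep_cols (n + 1) ((!) [x, y, z])"
  proof (rule indep_cols3[OF n V])
    fix s t r assume eq: "s \<cdot>\<^sub>v x + t \<cdot>\<^sub>v y + r \<cdot>\<^sub>v z = 0\<^sub>v (n + 2)"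
    have "B x (s \<cdot>\<^sub>v x + t \<cdot>\<^sub>v y + r \<cdot>\<^sub>v z) = s * (2 * (- \<gamma>))"
      "B y (s \<cdot>\<^sub>v x + t \<cdot>\<^sub>v y + r \<cdot>\<^sub>v z) = t * (2 * (- \<gamma>))"
      "B z (s \<cdot>\<^sub>v x + t \<cdot>\<^sub>v y + r \<cdot>\<^sub>v z) = r * (2 * (- \<gamma>))"
      using V BB BC by (simp_all add: B_add_right B_smult_right B_self QQ)
    then show "s = 0 \<and> t = 0 \<and> r = 0" unfolding eq B_zero using two \<gamma> by simp
  qed
  show ?thesis
  proof (rule proj_equivI[OF indep])
    show "in_vars (n + 1 + 1) F" using vars by (simp add: numeral_2_eq_2)
    show "- \<gamma> \<noteq> 0" using \<gamma> by simp
    show "peval Const F (\<lambda>i. \<Sum>j\<le>n + 1. Const ([x, y, z] ! j $ i) * Var j) =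
        Const (- \<gamma>) * (Var 0 ^ 2 + Var 1 ^ 2 + Var 2 ^ 2)"
      unfolding substitution3[OF n] QQ BB by (simp add: Const_hom.hom_zero distrib_left)
  qed
qed

lemma surface_normal_form:
  assumes n: "n = 2"
  obtains \<alpha> where "\<And>y. y ^ 2 + y + \<alpha> \<noteq> 0" "nonsingular (n + 1) F"
    "proj_equiv (n + 1) F (binary_form \<alpha> + Var 2 * Var 3)"
proof -
  obtain c d where c: "c \<in> U" and d: "d \<in> U" and Qd: "Q d \<noteq> 0" and cd: "B c d = Q d"
    and ind: "\<nexists>t. c = t \<cdot>\<^sub>v d"
    by (rule surface_basis[OF n])
  define \<mu> where "\<mu> = Q d"
  define \<alpha> where "\<alpha> = Q c / \<mu>"
  have \<mu>: "\<mu> \<noteq> 0" "Q d = \<mu>" "B c d = \<mu>" "B d c = \<mu>" "Q c = \<mu> * \<alpha>"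
    using Qd cd B_commute[of c d] by (simp_all add: \<mu>_def \<alpha>_def)
  have cV: "c \<in> V" and dV: "d \<in> V" using c d U_D by blast+
  have U_indep: "s = 0 \<and> t = 0" if z: "s \<cdot>\<^sub>v c + t \<cdot>\<^sub>v d = 0\<^sub>v (n + 2)" for s t
  proof -
    have e: "s * c $ i + t * d $ i = 0" if "i < n + 2" for i
      using arg_cong[OF z, of "\<lambda>x :: 'k vec. x $ i"] that cV dV by simp
    have "s = 0"
    proof (rule ccontr)
      assume "s \<noteq> 0"
      have "s \<cdot>\<^sub>v c = (- t) \<cdot>\<^sub>v d"
        using cV dV e by (intro eq_vecI) (auto simp: eq_neg_iff_add_eq_0)
      then show False using smult_smult_inverse[OF _ \<open>s \<noteq> 0\<close>] ind by blast
    qed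
    then have "t \<cdot>\<^sub>v d = 0\<^sub>v (n + 2)" using e dV by (intro eq_vecI) auto
    moreover have "d \<noteq> 0\<^sub>v (n + 2)" using Qd Q_smult[of d 0] dV by auto
    ultimately show ?thesis using \<open>s = 0\<close> smult_vec_eq_0_iff[OF dV] by blast
  qed
  \<comment> \<open>On the vectors \<open>c + y d\<close> the form is \<open>\<mu>\<close> times
    this quadratic, so a root would contradict anisotropy.\<close>
  have no_root: "y ^ 2 + y + \<alpha> \<noteq> 0" for y
  proof
    assume y: "y ^ 2 + y + \<alpha> = 0"
    have "Q (1 \<cdot>\<^sub>v c + y \<cdot>\<^sub>v d) = \<mu> * (y ^ 2 + y + \<alpha>)"
      using cV dV \<mu> by (simp add: Q_add Q_smult B_smult_left B_smult_right algebra_simps)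
    then have "1 \<cdot>\<^sub>v c + y \<cdot>\<^sub>v d = 0\<^sub>v (n + 2)"
      using y by (intro U_anisotropic U_closed c d) simp
    then show False using U_indep by fastforce
  qed
  \<comment> \<open>Up to sign and the factor \<open>\<mu> ^ 2\<close> this is the Gram determinant
    of \<open>c\<close> and \<open>d\<close>, so it decides nonsingularity. It equals 1 in
    characteristic two; otherwise its vanishing would give a double root.\<close>
  have disc: "1 - 4 * \<alpha> \<noteq> 0"
  proof (cases "(2 :: 'k) = 0")
    case True
    have "(4 :: 'k) = 2 * 2" by simp
    also have "\<dots> = 0" unfolding True by simp
    finally show ?thesis by simp
  next
    case False
    show ?thesis
    proof
      assume "1 - 4 * \<alpha> = 0"
      then have "0 ^ 2 = 1 - 4 * \<alpha>" by simp
      from quadratic_root[OF False this] no_root show False by blast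
    qed
  qed
  have indep0: "s = 0 \<and> t = 0 \<and> w = 0 \<and> u = 0"
    if z: "s \<cdot>\<^sub>v a + t \<cdot>\<^sub>v b + w \<cdot>\<^sub>v c + u \<cdot>\<^sub>v d = 0\<^sub>v (n + 2)" for s t w u
  proof -
    have "s \<cdot>\<^sub>v a + t \<cdot>\<^sub>v b + (w \<cdot>\<^sub>v c + u \<cdot>\<^sub>v d) = 0\<^sub>v (n + 2)"
      using z a b cV dV by (subst assoc_add_vec[symmetric, of _ "n + 2"]) auto
    from combination_eq_0[OF _ this] show ?thesis using U_indep U_closed c d by blast
  qed
  show ?thesis
  proof (rule that[of \<alpha>, OF no_root])
    have indep: "indep_cols (n + 1) ((!) [a, b, c, d])"
      by (rule indep_cols4[OF n a(1) b(1) cV dV indep0])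
    show "nonsingular (n + 1) F"
    proof (rule nonsingular_basis[OF indep])
      fix y :: "nat \<Rightarrow> 'k alg_closure"
      assume "\<And>j. (\<Sum>k\<le>n + 1. y k * to_ac (B ([a, b, c, d] ! k) ([a, b, c, d] ! j))) = 0"
      note polar0 = this[of 0] this[of 1] this[of 2] this[of 3]
      have y1: "y 1 = 0" and y0: "y 0 = 0"
        using polar0(1,2) n ab a b U_D[OF c] U_D[OF d] B_commute[of b a]
        by (simp_all add: numeral_2_eq_2 numeral_3_eq_3 B_self)
      have e2: "y 2 * to_ac (2 * (\<mu> * \<alpha>)) + y 3 * to_ac \<mu> = 0"
        and e3: "y 2 * to_ac \<mu> + y 3 * to_ac (2 * \<mu>) = 0"
        using polar0(3,4) n ab a b U_D[OF c] U_D[OF d] \<mu> y0 y1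
        by (simp_all add: numeral_2_eq_2 numeral_3_eq_3 B_self)
      have "to_ac \<mu> * (y 2 + 2 * y 3) = 0" using e3 by (simp add: algebra_simps)
      then have y2: "y 2 = - (2 * y 3)" using \<mu>(1) by (simp add: eq_neg_iff_add_eq_0)
      have "to_ac \<mu> * (y 3 * to_ac (1 - 4 * \<alpha>)) = 0"
        using e2 unfolding y2 by (simp add: algebra_simps)
      then have y3: "y 3 = 0" using \<mu>(1) disc by (simp del: to_ac_diff to_ac_mult)
      then show "\<forall>k\<le>n + 1. y k = 0"
        using y0 y1 y2 n by (auto simp: numeral_2_eq_2 numeral_3_eq_3 le_Suc_eq)
    qed
    \<comment> \<open>Rescaling \<open>b\<close> gives the hyperbolic part the same factor
      \<open>\<mu>\<close> as the anisotropic part.\<close>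
    let ?b = "\<mu> \<cdot>\<^sub>v b"
    have bV: "?b \<in> V" using b by simp
    have indep': "indep_cols (n + 1) ((!) [c, d, a, ?b])"
    proof (rule indep_cols4[OF n cV dV a(1) bV])
      fix s t w u assume z: "s \<cdot>\<^sub>v c + t \<cdot>\<^sub>v d + w \<cdot>\<^sub>v a + u \<cdot>\<^sub>v ?b = 0\<^sub>v (n + 2)"
      have "w \<cdot>\<^sub>v a + (u * \<mu>) \<cdot>\<^sub>v b + s \<cdot>\<^sub>v c + t \<cdot>\<^sub>v d = s \<cdot>\<^sub>v c + t \<cdot>\<^sub>v d + w \<cdot>\<^sub>v a + u \<cdot>\<^sub>v ?b"
        using a b cV dV by (intro eq_vecI) auto
      then show "s = 0 \<and> t = 0 \<and> w = 0 \<and> u = 0" using indep0[of w "u * \<mu>" s t] z \<mu>(1) by simp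
    qed
    show "proj_equiv (n + 1) F (binary_form \<alpha> + Var 2 * Var 3)"
    proof (rule proj_equivI[OF indep'])
      show "in_vars (n + 1 + 1) F" using vars by (simp add: numeral_2_eq_2)
      show "\<mu> \<noteq> 0" by (rule \<mu>(1))
      have g: "Q ?b = 0" "B c a = 0" "B d a = 0" "B c ?b = 0" "B d ?b = 0" "B a ?b = \<mu>"
        using a b ab U_D[OF c] U_D[OF d] by (simp_all add: Q_smult B_smult_right)
      show "peval Const F (\<lambda>i. \<Sum>j\<le>n + 1. Const ([c, d, a, ?b] ! j $ i) * Var j) =
          Const \<mu> * (binary_form \<alpha> + Var 2 * Var 3)"
        unfolding substitution4[OF n] g \<mu>(2,3,5) a(2) binary_form_def
        by (simp add: Const_hom.hom_zero Const_hom.hom_mult algebra_simps)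
    qed
  qed
qed

end

theorem theorem2:
  fixes F :: "'k::{finite,field} mpoly" and p r q n d :: nat
  assumes "Factorial_Ring.prime p" and "r \<ge> 1" and "q = p ^ r" and "CARD('k) = q"
    and "n \<ge> 1" and "d \<ge> 2"
    and "hypersurface (n + 1) d F"
    and "k_inv (n + 1) F = 0"
  shows "num_points (n + 1) F
           \<le> (d - 1) * q ^ n + (d - 2) * card (proj_space (n - 1) :: 'k vec set set) + 1
       \<and> (num_points (n + 1) F
            = (d - 1) * q ^ n + (d - 2) * card (proj_space (n - 1) :: 'k vec set set) + 1
          \<longleftrightarrow>
          d = 2 \<and>
          (n = 1 \<and> nonsingular (n + 1) F \<and>
             (odd q \<longrightarrow> proj_equiv (n + 1) F (Var 0 ^ 2 + Var 1 ^ 2 + Var 2 ^ 2))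
           \<or> n = 2 \<and> nonsingular (n + 1) F \<and>
             (\<exists>\<alpha>. Factorial_Ring.irreducible (binary_form \<alpha>)
                \<and> (even q \<longrightarrow> (\<Sum>i<r. \<alpha> ^ (2 ^ i)) = 1)
                \<and> (odd q \<longrightarrow> \<not> (\<exists>s. s ^ 2 = 1 - 4 * \<alpha>))
                \<and> proj_equiv (n + 1) F (binary_form \<alpha> + Var 2 * Var 3))))"
    (is "?N \<le> ?b \<and> (?N = ?b \<longleftrightarrow> d = 2 \<and> (?conic \<or> ?surface))")
proof -
  have F: "in_vars (n + 2) F" "homog d F"
    using assms(7) by (simp_all add: hypersurface_iff numeral_2_eq_2)
  interpret line_free_hypersurface F q n d
    using F assms by unfold_locales auto
  obtain x where x: "x \<in> V" "x \<noteq> 0\<^sub>v (n + 2)" "val F x = 0" by (rule rational_point)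
  have forward: "d = 2 \<and> (?conic \<or> ?surface)" if eq: "?N = ?b"
  proof -
    have up: "q * card zeros = upper" using eq num_points_eq_iff by blast
    have d2: "d = 2" by (rule equality_degree[OF up])
    interpret Q: line_free_quadric F q n
      using line_free_hypersurface_axioms unfolding d2 line_free_quadric_def .
    obtain y where "hyperbolic_quadric F q n x y"
      using Q.hyperbolic_pair[OF x(1,3)] sum_r_eq(1)[OF x up] unfolding d2 by blast
    then interpret H: hyperbolic_quadric F q n x y .
    \<comment> \<open>The anisotropic complement of the hyperbolic plane has dimension
      \<open>n\<close>, which is at most 2 over a finite field.\<close>
    have "n = 1 \<or> n = 2" using H.dimension_le_2 assms(5) by linarith
    then show ?thesis
    proof
      assume n1: "n = 1"
      have ?conic
        using n1 H.conic_nonsingular[OF n1] H.conic_normal_form[OF n1] odd_card_two_nonzero assms(4) by metis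
      then show ?thesis using d2 by blast
    next
      assume n2: "n = 2"
      obtain \<alpha> where \<alpha>: "\<And>y. y ^ 2 + y + \<alpha> \<noteq> 0" and ns: "nonsingular (n + 1) F"
        and pe: "proj_equiv (n + 1) F (binary_form \<alpha> + Var 2 * Var 3)"
        by (rule H.surface_normal_form[OF n2]) blast
      have "Factorial_Ring.irreducible (binary_form \<alpha>)" by (rule irreducible_binary_form[OF \<alpha>])
      moreover have "(\<Sum>i<r. \<alpha> ^ (2 ^ i)) = 1" if "even q"
      proof -
        have "2 dvd p" using that assms(3) by simp
        then have "p = 2" using assms(1) two_is_prime_nat primes_dvd_imp_eq by metis
        then show ?thesis
          using artin_schreier_trace[OF _ assms(2) \<alpha>] assms(3,4) by simp
      qed
      moreover have "\<not> (\<exists>s. s ^ 2 = 1 - 4 * \<alpha>)" if "odd q"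
      proof
        assume "\<exists>s. s ^ 2 = 1 - 4 * \<alpha>"
        then obtain s where s: "s ^ 2 = 1 - 4 * \<alpha>" by blast
        have "(2 :: 'k) \<noteq> 0" using odd_card_two_nonzero that assms(4) by metis
        then show False using quadratic_root[OF _ s] \<alpha> by blast
      qed
      ultimately have ?surface using n2 ns pe by blast
      then show ?thesis using d2 by blast
    qed
  qed
  have backward: "?N = ?b" if "d = 2" "?conic \<or> ?surface"
  proof -
    \<comment> \<open>Both normal forms include nonsingularity, which makes the chosen rational
      point \<open>x\<close> smooth; one smooth rational point is enough for the count.\<close>
    have "nonsingular (n + 1) F" using that(2) by blast
    then have "\<exists>v\<in>V. T x v \<noteq> 0" by (rule nonsingular_imp_smooth[OF _ x])
    then show ?thesis using sum_r_smooth_quadric[OF x that(1)] num_points_eq_iff by blast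
  qed
  show ?thesis using num_points_le forward backward by blast
qed

end
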